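(* Let $X$ be an L-embedded Banach space and let $Y \subseteq X$ be a closed nonreflexive subspace. Then $Y$ contains an asymptotic copy of $\ell^1$, that is, there is a sequence $(x_n)_{n\in\mathbb{N}}$ in $Y$ which spans $\ell^1$ asymptotically. In particular, every closed nonreflexive subspace $Y$ of an L-embedded Banach space $X$ fails the fixed point property.
   Context: Banach spaces are over the complex field (the result also holds for real Banach spaces). A Banach space $X$ is regarded as a subspace of its bidual $X''$ via the canonical embedding. A projection $P$ on a Banach space $Z$ is an L-projection if $\|z\| = \|Pz\| + \|z-Pz\|$ for all $z\in Z$. A Banach space $X$ is L-embedded if $X$ is the range of an L-projection on $X''$. A sequence $(x_n)$ of nonzero elements of a Banach space spans $\ell^1$ asymptotically (isometrically) if there is a sequence $(\delta_n)$ in $[0,1)$ tending to $0$ such that $\sum_{n=1}^\infty (1-\delta_n)|\alpha_n| \le \left\|\sum_{n=1}^\infty \alpha_n x_n\right\| \le \sum_{n=1}^\infty |\alpha_n|$ for all scalars $\alpha_n$ with $\sum_n|\alpha_n|<\infty$. A Banach space $X$ has the fixed point property if every contractive (not necessarily linear) map $f: C\to C$ on any non-empty closed bounded convex subset $C\subset X$ has a fixed point, where contractive means $\|f(x)-f(y)\|<\|x-y\|$ for all $x,y\in C$ with $x\ne y$. *)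

theory Defs
  imports "HOL-Analysis.Analysis" "HOL-Library.Function_Algebras"
begin

section \<open>Complex normed spaces\<close>

class scaleC =
  fixes scaleC :: "complex \<Rightarrow> 'a \<Rightarrow> 'a"  (infixr \<open>*\<^sub>C\<close> 75)

class complex_vector = scaleC + ab_group_add +
  assumes scaleC_add_right: "a *\<^sub>C (x + y) = a *\<^sub>C x + a *\<^sub>C y"
    and scaleC_add_left: "(a + b) *\<^sub>C x = a *\<^sub>C x + b *\<^sub>C x"
    and scaleC_scaleC: "a *\<^sub>C b *\<^sub>C x = (a * b) *\<^sub>C x"
    and scaleC_one: "1 *\<^sub>C x = x"

global_interpretation complex_vector:
  vector_space "scaleC :: complex \<Rightarrow> 'a \<Rightarrow> 'a::complex_vector"
  defines csubspace = complex_vector.subspace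
  by unfold_locales
    (simp_all add: scaleC_add_right scaleC_add_left scaleC_scaleC scaleC_one)

class complex_normed_vector = complex_vector + real_normed_vector +
  assumes scaleR_scaleC: "r *\<^sub>R x = complex_of_real r *\<^sub>C x"
    and norm_scaleC: "norm (a *\<^sub>C x) = cmod a * norm x"

instantiation complex :: complex_normed_vector
begin

definition scaleC_complex :: "complex \<Rightarrow> complex \<Rightarrow> complex"
  where "scaleC_complex a x = a * x"

instance
  by intro_classes
    (simp_all add: scaleC_complex_def algebra_simps norm_mult scaleR_conv_of_real)

end

instantiation "fun" :: (type, complex_vector) complex_vector
begin

definition scaleC_fun :: "complex \<Rightarrow> ('a \<Rightarrow> 'b) \<Rightarrow> 'a \<Rightarrow> 'b"
  where "scaleC_fun a f = (\<lambda>x. a *\<^sub>C f x)"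

instance
  by intro_classes
    (simp_all add: scaleC_fun_def fun_eq_iff
      scaleC_add_right scaleC_add_left scaleC_scaleC scaleC_one)

end


section \<open>Dual and bidual\<close>

text \<open>
  A normed space is given by a linear subspace \<open>S\<close> of the ambient type together
  with a norm \<open>N\<close> on \<open>S\<close>.  Since duals of subspaces are again sets of functions,
  the same construction can be iterated to obtain the bidual.
\<close>

definition clinear_on :: "'a::complex_vector set \<Rightarrow> ('a \<Rightarrow> 'b::complex_vector) \<Rightarrow> bool"
  where "clinear_on S f \<longleftrightarrow>
    (\<forall>x\<in>S. \<forall>y\<in>S. f (x + y) = f x + f y) \<and> (\<forall>c. \<forall>x\<in>S. f (c *\<^sub>C x) = c *\<^sub>C f x)"

text \<open>
  Functionals on \<open>S\<close> are represented by functions vanishing outside \<open>S\<close>; thus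
  each functional has exactly one representative, and the vector space operations
  of the dual are the pointwise ones of the function type.
\<close>

definition dual_space :: "'a::complex_vector set \<Rightarrow> ('a \<Rightarrow> real) \<Rightarrow> ('a \<Rightarrow> complex) set"
  where "dual_space S N = {f. clinear_on S f \<and>
    (\<exists>B. \<forall>x\<in>S. cmod (f x) \<le> B * N x) \<and> (\<forall>x. x \<notin> S \<longrightarrow> f x = 0)}"

definition dual_norm :: "'a::complex_vector set \<Rightarrow> ('a \<Rightarrow> real) \<Rightarrow> ('a \<Rightarrow> complex) \<Rightarrow> real"
  where "dual_norm S N f = (SUP x\<in>{x \<in> S. N x \<le> 1}. cmod (f x))"

definition bidual_space ::
    "'a::complex_vector set \<Rightarrow> ('a \<Rightarrow> real) \<Rightarrow> (('a \<Rightarrow> complex) \<Rightarrow> complex) set"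
  where "bidual_space S N = dual_space (dual_space S N) (dual_norm S N)"

definition bidual_norm ::
    "'a::complex_vector set \<Rightarrow> ('a \<Rightarrow> real) \<Rightarrow> (('a \<Rightarrow> complex) \<Rightarrow> complex) \<Rightarrow> real"
  where "bidual_norm S N = dual_norm (dual_space S N) (dual_norm S N)"

definition canonical_embedding ::
    "'a::complex_vector set \<Rightarrow> ('a \<Rightarrow> real) \<Rightarrow> 'a \<Rightarrow> ('a \<Rightarrow> complex) \<Rightarrow> complex"
  where "canonical_embedding S N x = (\<lambda>f. if f \<in> dual_space S N then f x else 0)"

definition reflexive_space :: "'a::complex_normed_vector set \<Rightarrow> bool"
  where "reflexive_space S \<longleftrightarrow> canonical_embedding S norm ` S = bidual_space S norm"


section \<open>L-embedded spaces\<close>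

text \<open>Boundedness of \<open>P\<close> is a consequence of the norm identity.\<close>

definition L_projection :: "'a::complex_vector set \<Rightarrow> ('a \<Rightarrow> real) \<Rightarrow> ('a \<Rightarrow> 'a) \<Rightarrow> bool"
  where "L_projection Z N P \<longleftrightarrow>
    P ` Z \<subseteq> Z \<and> clinear_on Z P \<and> (\<forall>z\<in>Z. P (P z) = P z) \<and>
    (\<forall>z\<in>Z. N z = N (P z) + N (z - P z))"

definition L_embedded :: "'a::complex_normed_vector set \<Rightarrow> bool"
  where "L_embedded S \<longleftrightarrow>
    (\<exists>P. L_projection (bidual_space S norm) (bidual_norm S norm) P \<and>
      P ` bidual_space S norm = canonical_embedding S norm ` S)"


section \<open>Asymptotic copies of $\ell^1$ and the fixed point property\<close>

text \<open>
  Convergence of \<open>\<Sum>n. \<alpha> n *\<^sub>C x n\<close> in a Banach space need not be demanded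
  separately: a sequence \<open>\<alpha>\<close> with a single nonzero entry shows that
  \<open>norm (x n) \<le> 1\<close>, so the series converges absolutely.
\<close>

definition spans_l1_asymptotically :: "(nat \<Rightarrow> 'a::complex_normed_vector) \<Rightarrow> bool"
  where "spans_l1_asymptotically x \<longleftrightarrow>
    (\<forall>n. x n \<noteq> 0) \<and>
    (\<exists>\<delta>::nat \<Rightarrow> real. (\<forall>n. \<delta> n \<in> {0..<1}) \<and> \<delta> \<longlonglongrightarrow> 0 \<and>
      (\<forall>\<alpha>::nat \<Rightarrow> complex. summable (\<lambda>n. cmod (\<alpha> n)) \<longrightarrow>
        (\<Sum>n. (1 - \<delta> n) * cmod (\<alpha> n)) \<le> norm (\<Sum>n. \<alpha> n *\<^sub>C x n) \<and>
        norm (\<Sum>n. \<alpha> n *\<^sub>C x n) \<le> (\<Sum>n. cmod (\<alpha> n))))"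

definition contractive_on :: "'a::metric_space set \<Rightarrow> ('a \<Rightarrow> 'a) \<Rightarrow> bool"
  where "contractive_on C f \<longleftrightarrow> (\<forall>x\<in>C. \<forall>y\<in>C. x \<noteq> y \<longrightarrow> dist (f x) (f y) < dist x y)"

definition fixed_point_property :: "'a::real_normed_vector set \<Rightarrow> bool"
  where "fixed_point_property S \<longleftrightarrow>
    (\<forall>C f. C \<noteq> {} \<and> C \<subseteq> S \<and> closedin (top_of_set S) C \<and> bounded C \<and> convex C \<and>
      f ` C \<subseteq> C \<and> contractive_on C f \<longrightarrow> (\<exists>x\<in>C. f x = x))"

end

theory Submission
  imports Defs
begin

text \<open>
  A functional in the bidual of \<open>Y\<close> that does not come from \<open>Y\<close> induces a functional \<open>\<phi>\<close> on the dual
  of \<open>X\<close>; its L-decomposition is \<open>\<phi> = x + \<psi>\<close> with \<open>x\<close> in \<open>X\<close> and a singular part \<open>\<psi> \<noteq> 0\<close>, which we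
  normalise. As \<open>norm (e + \<alpha> \<psi>) = norm e + cmod \<alpha>\<close> for all \<open>e\<close> in \<open>X\<close>, a Helly-type approximation of
  \<open>\<psi>\<close> by elements of \<open>Y - x\<close> of norm at most \<open>1 + \<epsilon>\<close> yields inductively a sequence \<open>z\<close> in \<open>Y - x\<close>
  that is asymptotically the unit vector basis of \<open>\<ell>\<^sup>1\<close>. The translate \<open>x\<close> cancels in the differences
  \<open>z (2 * n) - z (2 * n + 1)\<close>, whose normalisations therefore lie in \<open>Y\<close> and still span \<open>\<ell>\<^sup>1\<close>
  asymptotically.
\<close>

section \<open>The Hahn--Banach theorem\<close>

text \<open>The L-projection lives on the bidual of \<open>X\<close> and need not respect the bidual
  of \<open>Y\<close>. The functional \<phi> kills everything that annihilates \<open>Y\<close>, but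
  its component \<open>x\<close> need not lie in \<open>Y\<close>, so on those functionals \<psi>
  only agrees with \<open>- x\<close> (up to the normalisation). This is why \<psi> is approximated
  from \<open>Y - x\<close> and why differences are taken at the end. Matching \<psi> on finitely
  many functionals is enough: a step of the induction needs its estimate only on the compact set of
  bounded combinations of the vectors already found, and there a finite net of norming functionals
  decides. The difference of two consecutive vectors has norm close to 2, from above by the triangle
  inequality and from below by the \<open>\<ell>\<^sup>1\<close> estimate, so its normalisation
  costs a factor that tends to 1. The fixed point part uses that the lower constants tend to 1 and
  do not merely stay away from 0: weights decreasing strictly to 1 can then be fitted to a
  subsequence so that shifting coefficients strictly shrinks distances.\<close>

definition sublinear :: "('a::real_vector \<Rightarrow> real) \<Rightarrow> bool"
  where "sublinear p \<longleftrightarrow> (\<forall>x y. p (x + y) \<le> p x + p y) \<and> (\<forall>r\<ge>0. \<forall>x. p (r *\<^sub>R x) = r * p x)"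

text \<open>The reverse inequality for a positive factor is the assumed one for the inverse
  factor.\<close>

lemma sublinearI:
  assumes "\<And>x y. p (x + y) \<le> p x + p y"
    and "\<And>r x. r > 0 \<Longrightarrow> p (r *\<^sub>R x) \<le> r * p x" and "p 0 = 0"
  shows "sublinear p"
proof -
  have "p (r *\<^sub>R x) = r * p x" if "r \<ge> 0" for r x
  proof (cases "r = 0")
    case False
    then have r: "r > 0" using that by simp
    have "p (inverse r *\<^sub>R (r *\<^sub>R x)) \<le> inverse r * p (r *\<^sub>R x)"
      using r by (intro assms(2)) simp
    then have "r * p x \<le> p (r *\<^sub>R x)"
      using r by (simp add: field_simps)
    with assms(2)[OF r, of x] show ?thesis by simp
  qed (simp add: assms(3))
  then show ?thesis using assms(1) by (simp add: sublinear_def)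
qed

lemma sublinear_add: "sublinear p \<Longrightarrow> p (x + y) \<le> p x + p y"
  and sublinear_scale: "sublinear p \<Longrightarrow> r \<ge> 0 \<Longrightarrow> p (r *\<^sub>R x) = r * p x"
  by (auto simp: sublinear_def)

lemma sublinear_0: "sublinear p \<Longrightarrow> p 0 = 0"
  using sublinear_scale[of p 0 0] by simp

lemma sublinear_minus_le: "sublinear p \<Longrightarrow> - p (- x) \<le> p x"
  using sublinear_add[of p x "- x"] sublinear_0[of p] by simp

text \<open>The infimum is finite because of \<open>nonneg\<close>: subadditivity for
  \<open>- a i = - x + (x - a i)\<close> bounds every candidate below by \<open>- p (- x)\<close>.
  The index set is a convex cone with additive, positively homogeneous data, so that both a
  half-line (forcing a value in one direction) and a whole subspace (extending a functional) are
  instances.\<close>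

lemma sublinear_inf_convolution:
  fixes p :: "'a::real_vector \<Rightarrow> real" and I :: "'i::real_vector set"
  assumes p: "sublinear p"
    and I: "0 \<in> I" "\<And>i j. i \<in> I \<Longrightarrow> j \<in> I \<Longrightarrow> i + j \<in> I"
      "\<And>r i. r > 0 \<Longrightarrow> i \<in> I \<Longrightarrow> r *\<^sub>R i \<in> I"
    and a: "\<And>i j. i \<in> I \<Longrightarrow> j \<in> I \<Longrightarrow> a (i + j) = a i + a j"
      "\<And>r i. r > 0 \<Longrightarrow> i \<in> I \<Longrightarrow> a (r *\<^sub>R i) = r *\<^sub>R a i"
    and l: "\<And>i j. i \<in> I \<Longrightarrow> j \<in> I \<Longrightarrow> l (i + j) = l i + l j"
      "\<And>r i. r > 0 \<Longrightarrow> i \<in> I \<Longrightarrow> l (r *\<^sub>R i) = r * l i"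
    and nonneg: "\<And>i. i \<in> I \<Longrightarrow> 0 \<le> p (- a i) + l i"
  defines "q \<equiv> \<lambda>x. INF i\<in>I. p (x - a i) + l i"
  shows "sublinear q" and "\<And>x i. i \<in> I \<Longrightarrow> q x \<le> p (x - a i) + l i"
proof -
  have a0: "a 0 = 0" and l0: "l 0 = 0"
    using a(1)[OF I(1) I(1)] l(1)[OF I(1) I(1)] by auto
  have bdd: "bdd_below ((\<lambda>i. p (x - a i) + l i) ` I)" for x
  proof (rule bdd_belowI2)
    fix i assume "i \<in> I"
    then show "- p (- x) \<le> p (x - a i) + l i"
      using nonneg[of i] sublinear_add[OF p, of "- x" "x - a i"] by simp
  qed
  show le: "q x \<le> p (x - a i) + l i" if "i \<in> I" for x i
    unfolding q_def by (rule cINF_lower[OF bdd that])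
  have ge: "c \<le> q x" if "\<And>i. i \<in> I \<Longrightarrow> c \<le> p (x - a i) + l i" for c x
    unfolding q_def using that I(1) by (intro cINF_greatest) auto
  show "sublinear q"
  proof (rule sublinearI)
    fix x y
    have "q (x + y) - (p (y - a j) + l j) \<le> q x" if j: "j \<in> I" for j
    proof (rule ge)
      fix i assume i: "i \<in> I"
      have "q (x + y) \<le> p (x + y - a (i + j)) + l (i + j)"
        using I(2)[OF i j] by (rule le)
      also have "\<dots> = p ((x - a i) + (y - a j)) + (l i + l j)"
        by (simp add: a(1)[OF i j] l(1)[OF i j] algebra_simps)
      finally show "q (x + y) - (p (y - a j) + l j) \<le> p (x - a i) + l i"
        using sublinear_add[OF p, of "x - a i" "y - a j"] by simp
    qed
    then have "q (x + y) - q x \<le> q y" by (intro ge) (simp add: algebra_simps)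
    then show "q (x + y) \<le> q x + q y" by simp
  next
    fix r :: real and x assume r: "r > 0"
    have "q (r *\<^sub>R x) / r \<le> q x"
    proof (rule ge)
      fix i assume i: "i \<in> I"
      have "q (r *\<^sub>R x) \<le> p (r *\<^sub>R x - a (r *\<^sub>R i)) + l (r *\<^sub>R i)"
        using I(3)[OF r i] by (rule le)
      also have "\<dots> = r * (p (x - a i) + l i)"
        using sublinear_scale[OF p, of r "x - a i"] r
        by (simp add: a(2)[OF r i] l(2)[OF r i] algebra_simps)
      finally show "q (r *\<^sub>R x) / r \<le> p (x - a i) + l i"
        using r by (simp add: field_simps)
    qed
    then show "q (r *\<^sub>R x) \<le> r * q x" using r by (simp add: field_simps)
  next
    show "q 0 = 0"
      using le[OF I(1), of 0] ge[of 0 0] nonneg by (auto simp: a0 l0 sublinear_0[OF p])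
  qed
qed

text \<open>The common lower bound \<open>- p (- x)\<close> keeps the infimum finite. Subadditivity
  is where the chain condition enters: bounding \<open>m (x + y)\<close> by \<open>q x + r y\<close>
  involves two members, and the smaller of the two is itself subadditive.\<close>

lemma sublinear_chain_Inf:
  fixes C :: "('a::real_vector \<Rightarrow> real) set"
  assumes "C \<noteq> {}" and C: "\<And>q. q \<in> C \<Longrightarrow> sublinear q \<and> (\<forall>x. q x \<le> p x)"
    and chain: "\<And>q r. q \<in> C \<Longrightarrow> r \<in> C \<Longrightarrow> (\<forall>x. q x \<le> r x) \<or> (\<forall>x. r x \<le> q x)"
  defines "m \<equiv> \<lambda>x. INF q\<in>C. q x"
  shows "sublinear m" and "\<And>q x. q \<in> C \<Longrightarrow> m x \<le> q x"
proof -
  have bdd: "bdd_below ((\<lambda>q. q x) ` C)" for x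
  proof (rule bdd_belowI2)
    fix q assume "q \<in> C"
    then show "- p (- x) \<le> q x"
      using sublinear_minus_le[of q x] C[of q] by (smt (verit))
  qed
  show le: "m x \<le> q x" if "q \<in> C" for q x
    unfolding m_def by (rule cINF_lower[OF bdd that])
  have ge: "c \<le> m x" if "\<And>q. q \<in> C \<Longrightarrow> c \<le> q x" for c x
    unfolding m_def using that assms(1) by (intro cINF_greatest) auto
  show "sublinear m"
  proof (rule sublinearI)
    fix x y
    have "m (x + y) - r y \<le> m x" if r: "r \<in> C" for r
    proof (rule ge)
      fix q assume q: "q \<in> C"
      have "m (x + y) \<le> q x + r y"
        using chain[OF q r] le[OF q, of "x + y"] le[OF r, of "x + y"] C[OF q] C[OF r]
          sublinear_add[of q x y] sublinear_add[of r x y]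
        by (smt (verit))
      then show "m (x + y) - r y \<le> q x" by simp
    qed
    then have "m (x + y) - m x \<le> m y" by (intro ge) (simp add: algebra_simps)
    then show "m (x + y) \<le> m x + m y" by simp
  next
    fix r :: real and x assume r: "r > 0"
    have "m (r *\<^sub>R x) / r \<le> m x"
    proof (rule ge)
      fix q assume "q \<in> C"
      then show "m (r *\<^sub>R x) / r \<le> q x"
        using le[of q "r *\<^sub>R x"] C[of q] sublinear_scale[of q r x] r by (simp add: field_simps)
    qed
    then show "m (r *\<^sub>R x) \<le> r * m x" using r by (simp add: field_simps)
  next
    have "q 0 = 0" if "q \<in> C" for q using C[OF that] sublinear_0 by blast
    then have "(\<lambda>q. q 0) ` C = {0}"
      using assms(1) by (auto simp: image_iff)
    then show "m 0 = 0" by (simp add: m_def)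
  qed
qed

lemma minimal_sublinear_exists:
  fixes p :: "'a::real_vector \<Rightarrow> real"
  assumes "sublinear p"
  obtains g where "sublinear g" "\<And>x. g x \<le> p x"
    "\<And>q. sublinear q \<Longrightarrow> (\<And>x. q x \<le> g x) \<Longrightarrow> q = g"
proof -
  define A where "A = {q. sublinear q \<and> (\<forall>x. q x \<le> p x)}"
  \<comment> \<open>The order is reversed, so that upper bounds of chains are pointwise infima and a
    maximal element is a minimal sublinear functional.\<close>
  define R where "R = (\<lambda>q r :: 'a \<Rightarrow> real. \<forall>x. r x \<le> q x)"
  have "\<exists>m\<in>A. \<forall>q\<in>A. R m q \<longrightarrow> q = m"
  proof (rule predicate_Zorn)
    show "partial_order_on A (relation_of R A)"
      by (rule partial_order_on_relation_ofI)
        (auto simp: R_def fun_eq_iff intro: order.trans order.antisym)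
  next
    fix C assume C: "C \<in> Chains (relation_of R A)"
    then have CA: "C \<subseteq> A" and ch: "\<And>q r. q \<in> C \<Longrightarrow> r \<in> C \<Longrightarrow> R q r \<or> R r q"
      by (auto simp: Chains_def relation_of_def)
    show "\<exists>u\<in>A. \<forall>q\<in>C. R q u"
    proof (cases "C = {}")
      case True
      then show ?thesis using assms by (auto simp: A_def)
    next
      case False
      have *: "\<And>q. q \<in> C \<Longrightarrow> sublinear q \<and> (\<forall>x. q x \<le> p x)" using CA by (auto simp: A_def)
      have **: "(\<forall>x. q x \<le> r x) \<or> (\<forall>x. r x \<le> q x)" if "q \<in> C" "r \<in> C" for q r
        using ch[OF that] by (auto simp: R_def)
      have m: "sublinear (\<lambda>x. INF q\<in>C. q x)" "\<And>q x. q \<in> C \<Longrightarrow> (INF q\<in>C. q x) \<le> q x"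
        using sublinear_chain_Inf[of C p, OF False] * ** by blast+
      obtain q where "q \<in> C" using False by blast
      then have "(INF q\<in>C. q x) \<le> p x" for x
        using m(2)[of q x] *[of q] order.trans by blast
      then have "(\<lambda>x. INF q\<in>C. q x) \<in> A"
        using m(1) by (simp add: A_def)
      with m(2) show ?thesis unfolding R_def by (intro bexI[of _ "\<lambda>x. INF q\<in>C. q x"]) auto
    qed
  qed
  then obtain g where g: "g \<in> A" "\<forall>q\<in>A. R g q \<longrightarrow> q = g" by blast
  show ?thesis
  proof
    show "sublinear g" "\<And>x. g x \<le> p x" using g(1) by (auto simp: A_def)
    fix q assume "sublinear q" "\<And>x. q x \<le> g x"
    then show "q = g" using g unfolding A_def R_def by (smt (verit) mem_Collect_eq)
  qed
qed

text \<open>Take for \<open>r x\<close> the infimum of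
  \<open>q (x + t *\<^sub>R v) - t * q v\<close> over nonnegative \<open>t\<close>: the value
  \<open>t = 0\<close> gives domination by \<open>q\<close>, and \<open>t = 1\<close> at
  \<open>- v\<close> gives the last bound. Any linear functional below \<open>r\<close> is then at
  least \<open>q v\<close> at \<open>v\<close>.\<close>

lemma sublinear_ray:
  fixes q :: "'a::real_vector \<Rightarrow> real"
  assumes q: "sublinear q"
  obtains r where "sublinear r" "\<And>x. r x \<le> q x" "r (- v) \<le> - q v"
proof -
  let ?a = "\<lambda>t. - (t *\<^sub>R v)" and ?l = "\<lambda>t. - (t * q v)"
  define r where "r = (\<lambda>x. INF t\<in>{0..}. q (x - ?a t) + ?l t)"
  have *: "sublinear r" "\<And>x t. t \<in> {0..} \<Longrightarrow> r x \<le> q (x - ?a t) + ?l t"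
    unfolding r_def
    by (rule sublinear_inf_convolution[OF q];
        auto simp: algebra_simps sublinear_scale[OF q])+
  show ?thesis
    by (rule that[OF *(1)]) (use *(2)[of 0] *(2)[of 1 "- v"] sublinear_0[OF q] in auto)
qed

text \<open>Lowering a minimal \<open>g\<close> along a ray cannot change it, hence
  \<open>g (- v) \<le> - g v\<close>. So \<open>g\<close> is odd, and an odd subadditive function is
  additive.\<close>

lemma minimal_sublinear_linear:
  fixes g :: "'a::real_vector \<Rightarrow> real"
  assumes g: "sublinear g" and minimal: "\<And>q. sublinear q \<Longrightarrow> (\<And>x. q x \<le> g x) \<Longrightarrow> q = g"
  shows "linear g"
proof -
  have neg: "g (- v) = - g v" for v
  proof -
    obtain r where r: "sublinear r" "\<And>x. r x \<le> g x" "r (- v) \<le> - g v"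
      using sublinear_ray[OF g] by blast
    then have "r = g" by (intro minimal)
    with r(3) sublinear_minus_le[OF g, of "- v"] show ?thesis by simp
  qed
  show ?thesis
  proof (rule linearI)
    fix x y show "g (x + y) = g x + g y"
      using sublinear_add[OF g, of x y] sublinear_add[OF g, of "- x" "- y"] neg[of x] neg[of y]
        neg[of "x + y"] by simp
  next
    fix r :: real and x
    show "g (r *\<^sub>R x) = r *\<^sub>R g x"
      using sublinear_scale[OF g, of r x] sublinear_scale[OF g, of "- r" x] neg[of "r *\<^sub>R x"]
      by (cases "r \<ge> 0") auto
  qed
qed

text \<open>Values prescribed on a subspace are to be encoded in \<open>p\<close> by an infimal
  convolution. Passing to \<open>r\<close> before minimising is what forces equality at
  \<open>v\<close>.\<close>

theorem Hahn_Banach_sublinear: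
  fixes p :: "'a::real_vector \<Rightarrow> real"
  assumes p: "sublinear p"
  obtains g where "linear g" "\<And>x. g x \<le> p x" "g v = p v"
proof -
  obtain r where r: "sublinear r" "\<And>x. r x \<le> p x" "r (- v) \<le> - p v"
    using sublinear_ray[OF p] by blast
  obtain g where g: "sublinear g" "\<And>x. g x \<le> r x"
      "\<And>q. sublinear q \<Longrightarrow> (\<And>x. q x \<le> g x) \<Longrightarrow> q = g"
    using minimal_sublinear_exists[OF r(1)] by blast
  have lin: "linear g" by (rule minimal_sublinear_linear[OF g(1)]) (fact g(3))
  show ?thesis
  proof
    show le: "g x \<le> p x" for x using g(2) r(2) order.trans by blast
    show "g v = p v"
      using le[of v] g(2)[of "- v"] r(3) linear_neg[OF lin, of v] by simp
  qed (fact lin)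
qed

text \<open>The last conclusion makes the real part of the extension as large as possible at
  \<open>v\<close>. For \<open>f = 0\<close> and \<open>B = 1\<close> it says that
  \<open>Re (h v)\<close> is at least the distance from \<open>v\<close> to \<open>S\<close>. One
  theorem thus supplies norm-preserving extensions, functionals separating a point from a closed
  subspace, and norming functionals (\<open>S = {0}\<close>).\<close>

theorem Hahn_Banach_complex:
  fixes S :: "'a::complex_normed_vector set" and f :: "'a \<Rightarrow> complex"
  assumes S: "csubspace S" and f: "clinear_on S f"
    and bound: "\<And>s. s \<in> S \<Longrightarrow> cmod (f s) \<le> B * norm s" and B: "B \<ge> 0"
  obtains h where "clinear_on UNIV h" "\<And>s. s \<in> S \<Longrightarrow> h s = f s"
    "\<And>x. cmod (h x) \<le> B * norm x"
    "\<And>d. (\<And>s. s \<in> S \<Longrightarrow> d \<le> Re (f s) + B * norm (v - s)) \<Longrightarrow> d \<le> Re (h v)"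
proof -
  have S0: "0 \<in> S" and Sadd: "\<And>x y. x \<in> S \<Longrightarrow> y \<in> S \<Longrightarrow> x + y \<in> S"
    and Sscale: "\<And>c x. x \<in> S \<Longrightarrow> c *\<^sub>C x \<in> S"
    using S by (auto simp: complex_vector.subspace_def)
  have fadd: "\<And>x y. x \<in> S \<Longrightarrow> y \<in> S \<Longrightarrow> f (x + y) = f x + f y"
    and fscale: "\<And>c x. x \<in> S \<Longrightarrow> f (c *\<^sub>C x) = c * f x"
    using f by (auto simp: clinear_on_def scaleC_complex_def)
  define p where "p = (\<lambda>x::'a. B * norm x)"
  have p: "sublinear p"
    unfolding p_def using B
    by (intro sublinearI) (auto simp: norm_triangle_ineq mult_left_mono simp flip: distrib_left)
  \<comment> \<open>The infimal convolution of \<open>p\<close> with \<open>Re f\<close> lies below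
    \<open>p\<close> everywhere and below \<open>Re f\<close> on \<open>S\<close>. As
    \<open>S\<close> is symmetric, a linear functional below \<open>q\<close> must coincide with
    \<open>Re f\<close> on \<open>S\<close>.\<close>
  define q where "q = (\<lambda>x::'a. INF s\<in>S. p (x - s) + Re (f s))"
  have pos: "0 \<le> p (- s) + Re (f s)" if "s \<in> S" for s
    using bound[OF that] abs_Re_le_cmod[of "f s"] by (simp add: p_def)
  have q: "sublinear q" "\<And>x s. s \<in> S \<Longrightarrow> q x \<le> p (x - s) + Re (f s)"
    unfolding q_def
    by (rule sublinear_inf_convolution[OF p S0, where a="\<lambda>s. s" and l="\<lambda>s. Re (f s)"];
        auto simp: Sadd Sscale fadd fscale scaleR_scaleC pos)+
  obtain g where g: "linear g" "\<And>x. g x \<le> q x" "g v = q v"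
    using Hahn_Banach_sublinear[OF q(1)] by blast
  have gp: "g x \<le> B * norm x" for x
  proof -
    have "f 0 = 0" using fscale[OF S0, of 0] by simp
    then show ?thesis using g(2)[of x] q(2)[OF S0, of x] by (simp add: p_def)
  qed
  have gf: "g s = Re (f s)" if s: "s \<in> S" for s
  proof -
    have "- s \<in> S" "f (- s) = - f s"
      using Sscale[OF s, of "-1"] fscale[OF s, of "-1"] by auto
    then show ?thesis
      using g(2)[of s] q(2)[OF s, of s] g(2)[of "- s"] q(2)[of "- s" "- s"] linear_neg[OF g(1), of s]
      by (simp add: p_def)
  qed
  define h where "h = (\<lambda>x. Complex (g x) (- g (\<i> *\<^sub>C x)))"
  have gR: "g (complex_of_real r *\<^sub>C x) = r * g x" for r x
    using linear_cmul[OF g(1), of r x] by (simp add: scaleR_scaleC)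
  have hadd: "h (x + y) = h x + h y" for x y
    by (simp add: h_def linear_add[OF g(1)] scaleC_add_right complex_eq_iff)
  have hscale: "h (c *\<^sub>C x) = c * h x" for c x
  proof -
    have "c *\<^sub>C x = complex_of_real (Re c) *\<^sub>C x + complex_of_real (Im c) *\<^sub>C \<i> *\<^sub>C x"
      using complex_eq[of c] by (metis scaleC_add_left scaleC_scaleC mult.commute)
    moreover have "\<i> *\<^sub>C c *\<^sub>C x
        = complex_of_real (Re c) *\<^sub>C \<i> *\<^sub>C x + complex_of_real (- Im c) *\<^sub>C x"
      unfolding scaleC_scaleC scaleC_add_left[symmetric]
      by (rule arg_cong[where f="\<lambda>c. c *\<^sub>C x"]) (simp add: complex_eq_iff)
    ultimately have "g (c *\<^sub>C x) = Re c * g x + Im c * g (\<i> *\<^sub>C x)"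
      "g (\<i> *\<^sub>C c *\<^sub>C x) = Re c * g (\<i> *\<^sub>C x) - Im c * g x"
      by (simp_all only: linear_add[OF g(1)] gR)
    then show ?thesis by (simp add: h_def complex_eq_iff)
  qed
  show ?thesis
  proof
    show "clinear_on UNIV h" by (simp add: clinear_on_def hadd hscale scaleC_complex_def)
    show "h s = f s" if "s \<in> S" for s
      using gf[OF that] gf[OF Sscale[OF that, of \<i>]] fscale[OF that, of \<i>]
      by (simp add: h_def complex_eq_iff)
    show "cmod (h x) \<le> B * norm x" for x
    proof (cases "h x = 0")
      case True
      then show ?thesis using B by simp
    next
      case False
      define c where "c = cnj (h x) / complex_of_real (cmod (h x))"
      have c: "cmod c = 1" using False by (simp add: c_def norm_divide)
      have "c * h x = complex_of_real (cmod (h x))"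
        using False by (simp add: c_def complex_norm_square[symmetric] power2_eq_square mult.commute)
      then have "cmod (h x) = Re (h (c *\<^sub>C x))" by (simp add: hscale)
      also have "\<dots> = g (c *\<^sub>C x)" by (simp add: h_def)
      also have "\<dots> \<le> B * norm x" using gp[of "c *\<^sub>C x"] c by (simp add: norm_scaleC)
      finally show ?thesis .
    qed
    show "d \<le> Re (h v)" if "\<And>s. s \<in> S \<Longrightarrow> d \<le> Re (f s) + B * norm (v - s)" for d
    proof -
      have "d \<le> q v" unfolding q_def p_def
        using that S0 by (intro cINF_greatest) (auto simp: add.commute)
      then show ?thesis using g(3) by (simp add: h_def)
    qed
  qed
qed

section \<open>L-embedded spaces and singular functionals\<close>

text \<open>These properties pass from \<open>N\<close> to the dual norm, so the same estimates can
  be applied to the space, its dual and its bidual.\<close>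

definition homogeneous_on :: "'a::complex_vector set \<Rightarrow> ('a \<Rightarrow> real) \<Rightarrow> bool"
  where "homogeneous_on S N \<longleftrightarrow>
    csubspace S \<and> (\<forall>x\<in>S. 0 \<le> N x) \<and> (\<forall>c. \<forall>x\<in>S. N (c *\<^sub>C x) = cmod c * N x)"

lemma homogeneous_on_norm:
  fixes S :: "'a::complex_normed_vector set"
  shows "csubspace S \<Longrightarrow> homogeneous_on S norm"
  by (simp add: homogeneous_on_def norm_scaleC)

lemma homogeneous_on_zero:
  assumes "homogeneous_on S N" shows "0 \<in> S" "N 0 = 0"
proof -
  show "0 \<in> S" using assms by (simp add: homogeneous_on_def complex_vector.subspace_0)
  moreover have "N (0 *\<^sub>C 0) = cmod 0 * N 0"
    using assms calculation unfolding homogeneous_on_def by blast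
  ultimately show "N 0 = 0" by simp
qed

lemma clinear_on_add: "clinear_on S f \<Longrightarrow> x \<in> S \<Longrightarrow> y \<in> S \<Longrightarrow> f (x + y) = f x + f y"
  and clinear_on_scale: "clinear_on S f \<Longrightarrow> x \<in> S \<Longrightarrow> f (c *\<^sub>C x) = c *\<^sub>C f x"
  by (auto simp: clinear_on_def)

lemma clinear_on_diff:
  assumes "csubspace S" "clinear_on S f" "x \<in> S" "y \<in> S"
  shows "f (x - y) = f x - f y"
proof -
  have "(-1) *\<^sub>C y \<in> S" using assms by (intro complex_vector.subspace_scale)
  then have "f (x + (-1) *\<^sub>C y) = f x + (-1) *\<^sub>C f y"
    using assms clinear_on_add clinear_on_scale by metis
  then show ?thesis by simp
qed

lemma csubspace_dual_space: "csubspace (dual_space S N)"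
proof (rule complex_vector.subspaceI)
  show "0 \<in> dual_space S N"
    by (auto simp: dual_space_def clinear_on_def intro: exI[of _ 0])
next
  fix f g assume fg: "f \<in> dual_space S N" "g \<in> dual_space S N"
  then obtain A B where "\<forall>x\<in>S. cmod (f x) \<le> A * N x" "\<forall>x\<in>S. cmod (g x) \<le> B * N x"
    by (auto simp: dual_space_def)
  then have "\<forall>x\<in>S. cmod (f x + g x) \<le> (A + B) * N x"
    by (auto simp: algebra_simps intro!: norm_triangle_le add_mono)
  then show "f + g \<in> dual_space S N"
    using fg by (auto simp: dual_space_def clinear_on_def scaleC_add_right)
next
  fix c f assume f: "f \<in> dual_space S N"
  then obtain A where "\<forall>x\<in>S. cmod (f x) \<le> A * N x"
    by (auto simp: dual_space_def)
  then have "\<forall>x\<in>S. cmod (c * f x) \<le> (cmod c * A) * N x"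
    by (auto simp: norm_mult mult.assoc intro!: mult_left_mono)
  moreover have "clinear_on S (c *\<^sub>C f)"
    using f by (auto simp: dual_space_def clinear_on_def scaleC_fun_def scaleC_complex_def algebra_simps)
  ultimately show "c *\<^sub>C f \<in> dual_space S N"
    using f by (auto simp: dual_space_def scaleC_fun_def scaleC_complex_def)
qed

lemma dual_norm_le:
  assumes "homogeneous_on S N" "B \<ge> 0" "\<And>x. x \<in> S \<Longrightarrow> cmod (f x) \<le> B * N x"
  shows "dual_norm S N f \<le> B"
  unfolding dual_norm_def
proof (rule cSUP_least)
  show "{x \<in> S. N x \<le> 1} \<noteq> {}"
    using homogeneous_on_zero[OF assms(1)] by force
  fix x assume "x \<in> {x \<in> S. N x \<le> 1}"
  then show "cmod (f x) \<le> B"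
    using assms(3)[of x] mult_left_mono[of "N x" 1 B] assms(2) by auto
qed

lemma dual_norm_bdd:
  assumes "homogeneous_on S N" "f \<in> dual_space S N"
  shows "bdd_above ((\<lambda>x. cmod (f x)) ` {x \<in> S. N x \<le> 1})"
proof -
  obtain B where B: "\<forall>x\<in>S. cmod (f x) \<le> B * N x"
    using assms by (auto simp: dual_space_def)
  show ?thesis
  proof (rule bdd_aboveI2)
    fix x assume x: "x \<in> {x \<in> S. N x \<le> 1}"
    have "B * N x \<le> \<bar>B\<bar> * 1"
      using x assms(1) by (intro mult_mono) (auto simp: homogeneous_on_def)
    then show "cmod (f x) \<le> \<bar>B\<bar>" using B x by force
  qed
qed

lemma dual_norm_nonneg:
  assumes "homogeneous_on S N" "f \<in> dual_space S N"
  shows "0 \<le> dual_norm S N f"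
proof -
  have "cmod (f 0) \<le> dual_norm S N f"
    unfolding dual_norm_def
    by (rule cSUP_upper[OF _ dual_norm_bdd[OF assms]]) (simp add: homogeneous_on_zero[OF assms(1)])
  then show ?thesis using norm_ge_zero order.trans by blast
qed

lemma dual_norm_bound:
  assumes h: "homogeneous_on S N" and f: "f \<in> dual_space S N" and x: "x \<in> S"
  shows "cmod (f x) \<le> dual_norm S N f * N x"
proof (cases "N x = 0")
  \<comment> \<open>\<open>N\<close> may vanish at a nonzero vector; the boundedness of
    \<open>f\<close> then gives \<open>f x = 0\<close>, and no rescaling is possible.\<close>
  case True
  then show ?thesis using f x by (auto simp: dual_space_def)
next
  case False
  then have N: "N x > 0" using h x by (auto simp: homogeneous_on_def order_less_le)
  let ?y = "complex_of_real (inverse (N x)) *\<^sub>C x"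
  have y: "?y \<in> S" "N ?y = 1"
    using h x N by (auto simp: homogeneous_on_def complex_vector.subspace_scale norm_inverse)
  have "?y \<in> {x \<in> S. N x \<le> 1}" using y by auto
  then have "cmod (f ?y) \<le> dual_norm S N f"
    unfolding dual_norm_def by (rule cSUP_upper[OF _ dual_norm_bdd[OF h f]])
  moreover have "f ?y = complex_of_real (inverse (N x)) * f x"
    using f x by (auto simp: dual_space_def clinear_on_def scaleC_complex_def)
  ultimately have "inverse (N x) * cmod (f x) \<le> dual_norm S N f"
    using N by (simp only: norm_mult norm_of_real) simp
  then show ?thesis using N by (simp add: field_simps)
qed

lemma dual_norm_approx:
  assumes "homogeneous_on S N" "f \<in> dual_space S N" "r < dual_norm S N f"
  obtains x where "x \<in> S" "N x \<le> 1" "r < cmod (f x)"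
proof -
  have "{x \<in> S. N x \<le> 1} \<noteq> {}"
    using homogeneous_on_zero[OF assms(1)] by force
  then show ?thesis
    using assms(3) that less_cSUP_iff[OF _ dual_norm_bdd[OF assms(1,2)], of r]
    unfolding dual_norm_def by blast
qed

text \<open>One inequality follows from the pointwise bound; the other is the same inequality for
  the factor \<open>inverse c\<close> and the functional \<open>c *\<^sub>C f\<close>.\<close>

lemma homogeneous_on_dual:
  assumes h: "homogeneous_on S N"
  shows "homogeneous_on (dual_space S N) (dual_norm S N)"
proof -
  have D: "csubspace (dual_space S N)" by (rule csubspace_dual_space)
  have le: "dual_norm S N (c *\<^sub>C f) \<le> cmod c * dual_norm S N f" if f: "f \<in> dual_space S N" for c f
  proof (rule dual_norm_le[OF h])
    show "0 \<le> cmod c * dual_norm S N f" using dual_norm_nonneg[OF h f] by simp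
    fix x assume "x \<in> S"
    then show "cmod ((c *\<^sub>C f) x) \<le> cmod c * dual_norm S N f * N x"
      using dual_norm_bound[OF h f, of x]
      by (simp add: scaleC_fun_def scaleC_complex_def norm_mult mult.assoc mult_left_mono)
  qed
  have "dual_norm S N (c *\<^sub>C f) = cmod c * dual_norm S N f" if f: "f \<in> dual_space S N" for c f
  proof (cases "c = 0")
    case True
    have "(0::'a \<Rightarrow> complex) \<in> dual_space S N" using D by (rule complex_vector.subspace_0)
    then show ?thesis using True le[OF f, of c] dual_norm_nonneg[OF h, of 0] by simp
  next
    case False
    have cf: "c *\<^sub>C f \<in> dual_space S N" using D f by (rule complex_vector.subspace_scale)
    have "dual_norm S N (inverse c *\<^sub>C c *\<^sub>C f) \<le> cmod (inverse c) * dual_norm S N (c *\<^sub>C f)"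
      using cf by (rule le)
    then have "dual_norm S N f \<le> inverse (cmod c) * dual_norm S N (c *\<^sub>C f)"
      using False by (simp add: norm_inverse)
    then have "cmod c * dual_norm S N f \<le> dual_norm S N (c *\<^sub>C f)"
      using False by (simp add: field_simps)
    with le[OF f, of c] show ?thesis by simp
  qed
  then show ?thesis using D dual_norm_nonneg[OF h] by (simp add: homogeneous_on_def)
qed

section \<open>Canonical embedding and functionals on the dual\<close>

lemma canonical_embedding_in_bidual:
  assumes h: "homogeneous_on S N" and x: "x \<in> S"
  shows "canonical_embedding S N x \<in> bidual_space S N"
proof -
  let ?D = "dual_space S N"
  have D: "csubspace ?D" by (rule csubspace_dual_space)
  have "\<forall>f\<in>?D. cmod (canonical_embedding S N x f) \<le> N x * dual_norm S N f"
    using dual_norm_bound[OF h _ x] by (simp add: canonical_embedding_def mult.commute)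
  moreover have "clinear_on ?D (canonical_embedding S N x)"
    using complex_vector.subspace_add[OF D] complex_vector.subspace_scale[OF D]
    by (simp add: clinear_on_def canonical_embedding_def scaleC_fun_def)
  ultimately show ?thesis
    unfolding bidual_space_def dual_space_def[of ?D]
    by (auto simp: canonical_embedding_def)
qed

lemma dual_spaceI:
  "clinear_on UNIV f \<Longrightarrow> (\<And>x. cmod (f x) \<le> B * norm x) \<Longrightarrow> f \<in> dual_space UNIV norm"
  by (auto simp: dual_space_def)

text \<open>A norming functional for \<open>e\<close> is the separation from the subspace
  \<open>{0}\<close>, whose distance to \<open>e\<close> is \<open>norm e\<close>.\<close>

lemma norm_le_bidual_norm_canonical_embedding:
  fixes e :: "'a::complex_normed_vector"
  shows "norm e \<le> bidual_norm UNIV norm (canonical_embedding UNIV norm e)"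
proof -
  have h: "homogeneous_on (UNIV :: 'a set) norm" by (simp add: homogeneous_on_norm complex_vector.subspace_UNIV)
  have "csubspace {0::'a}" by simp
  moreover have "clinear_on {0::'a} (\<lambda>_. 0::complex)" by (simp add: clinear_on_def)
  ultimately obtain f where f: "clinear_on UNIV f" "\<And>x. cmod (f x) \<le> 1 * norm x"
      "\<And>d. (\<And>s. s \<in> {0::'a} \<Longrightarrow> d \<le> Re 0 + 1 * norm (e - s)) \<Longrightarrow> d \<le> Re (f e)"
    by (rule Hahn_Banach_complex[where B=1 and v=e]) auto
  have fD: "f \<in> dual_space UNIV norm" using f(1,2) by (rule dual_spaceI)
  let ?c = "canonical_embedding UNIV norm e"
  have c: "?c \<in> dual_space (dual_space UNIV norm) (dual_norm UNIV norm)"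
    using canonical_embedding_in_bidual[OF h] by (simp add: bidual_space_def)
  have "norm e \<le> Re (f e)" by (rule f(3)) simp
  also have "\<dots> \<le> cmod (?c f)" using fD complex_Re_le_cmod by (simp add: canonical_embedding_def)
  also have "\<dots> \<le> bidual_norm UNIV norm ?c * dual_norm UNIV norm f"
    unfolding bidual_norm_def by (rule dual_norm_bound[OF homogeneous_on_dual[OF h] c fD])
  also have "\<dots> \<le> bidual_norm UNIV norm ?c * 1"
    unfolding bidual_norm_def
    using dual_norm_nonneg[OF homogeneous_on_dual[OF h] c] dual_norm_le[OF h _ f(2)]
    by (intro mult_left_mono) auto
  finally show ?thesis by simp
qed

text \<open>A functional \<open>y''\<close> in the bidual of \<open>Y\<close> is composed with the
  restriction of functionals from the whole space to \<open>Y\<close>. If the result were evaluation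
  at some \<open>x\<close>, then \<open>x\<close> would lie in \<open>Y\<close> because
  \<open>Y\<close> is closed, and \<open>y''\<close> would be evaluation at \<open>x\<close>,
  because every functional on \<open>Y\<close> is a restriction.\<close>

lemma bidual_functional_of_subspace:
  fixes Y :: "'a::complex_normed_vector set"
  assumes Y: "csubspace Y" "closed Y" "\<not> reflexive_space Y"
  obtains \<phi> where "\<phi> \<in> bidual_space UNIV norm" "\<phi> \<notin> range (canonical_embedding UNIV norm)"
    "\<And>g. g \<in> dual_space UNIV norm \<Longrightarrow> (\<And>y. y \<in> Y \<Longrightarrow> g y = 0) \<Longrightarrow> \<phi> g = 0"
proof -
  let ?D = "dual_space (UNIV :: 'a set) norm"
  have h: "homogeneous_on (UNIV :: 'a set) norm" by (simp add: homogeneous_on_norm complex_vector.subspace_UNIV)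
  have hY: "homogeneous_on Y norm" by (rule homogeneous_on_norm[OF Y(1)])
  have D: "csubspace ?D" by (rule csubspace_dual_space)
  obtain y'' where y'': "y'' \<in> bidual_space Y norm" "y'' \<notin> canonical_embedding Y norm ` Y"
    using Y(3) canonical_embedding_in_bidual[OF hY] by (auto simp: reflexive_space_def)
  have lin: "clinear_on (dual_space Y norm) y''"
    and y''0: "\<And>g. g \<notin> dual_space Y norm \<Longrightarrow> y'' g = 0"
    using y''(1) by (auto simp: bidual_space_def dual_space_def[of "dual_space Y norm"])
  define res where "res = (\<lambda>(f :: 'a \<Rightarrow> complex) x. if x \<in> Y then f x else 0)"
  have resD: "res f \<in> dual_space Y norm" if "f \<in> ?D" for f
    using that Y(1) unfolding res_def dual_space_def clinear_on_def
    by (auto simp: complex_vector.subspace_add complex_vector.subspace_scale)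
  have res_norm: "dual_norm Y norm (res f) \<le> dual_norm UNIV norm f" if "f \<in> ?D" for f
    using dual_norm_bound[OF h that] dual_norm_nonneg[OF h that]
    by (intro dual_norm_le[OF hY]) (auto simp: res_def)
  define \<phi> where "\<phi> = (\<lambda>f. if f \<in> ?D then y'' (res f) else 0)"
  have "res (f + g) = res f + res g" "res (c *\<^sub>C f) = c *\<^sub>C res f" for f g c
    by (auto simp: res_def fun_eq_iff scaleC_fun_def)
  then have "clinear_on ?D \<phi>"
    using resD complex_vector.subspace_add[OF D] complex_vector.subspace_scale[OF D]
    by (simp add: clinear_on_def \<phi>_def clinear_on_add[OF lin] clinear_on_scale[OF lin])
  moreover have "\<forall>f\<in>?D. cmod (\<phi> f) \<le> bidual_norm Y norm y'' * dual_norm UNIV norm f"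
  proof
    fix f assume f: "f \<in> ?D"
    have y: "y'' \<in> dual_space (dual_space Y norm) (dual_norm Y norm)"
      using y''(1) by (simp add: bidual_space_def)
    have "cmod (y'' (res f)) \<le> bidual_norm Y norm y'' * dual_norm Y norm (res f)"
      unfolding bidual_norm_def
      by (rule dual_norm_bound[OF homogeneous_on_dual[OF hY] y resD[OF f]])
    also have "\<dots> \<le> bidual_norm Y norm y'' * dual_norm UNIV norm f"
      unfolding bidual_norm_def
      by (rule mult_left_mono[OF res_norm[OF f] dual_norm_nonneg[OF homogeneous_on_dual[OF hY] y]])
    finally show "cmod (\<phi> f) \<le> bidual_norm Y norm y'' * dual_norm UNIV norm f"
      using f by (simp add: \<phi>_def)
  qed
  ultimately have \<phi>: "\<phi> \<in> bidual_space UNIV norm"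
    unfolding bidual_space_def dual_space_def[of ?D] by (auto simp: \<phi>_def)
  have annihilates: "\<phi> g = 0" if "g \<in> ?D" "\<And>y. y \<in> Y \<Longrightarrow> g y = 0" for g
  proof -
    have "res g = 0" using that(2) by (auto simp: res_def)
    moreover have "y'' (0 *\<^sub>C 0) = 0 *\<^sub>C y'' 0"
      by (rule clinear_on_scale[OF lin complex_vector.subspace_0[OF csubspace_dual_space]])
    ultimately show ?thesis using that(1) by (simp add: \<phi>_def)
  qed
  have "\<phi> \<noteq> canonical_embedding UNIV norm x" for x
  proof
    assume eq: "\<phi> = canonical_embedding UNIV norm x"
    \<comment> \<open>A functional that annihilates \<open>Y\<close> but not \<open>x\<close> would
      be sent to 0 by \<phi> and at the same time to its value at \<open>x\<close>.\<close>
    have "x \<in> Y"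
    proof (rule ccontr)
      assume "x \<notin> Y"
      then obtain d where d: "d > 0" "ball x d \<inter> Y = {}"
        using Y(2) by (metis Compl_iff closed_def disjoint_eq_subset_Compl open_contains_ball_eq)
      have "clinear_on Y (\<lambda>_. 0::complex)" by (simp add: clinear_on_def)
      then obtain f where f: "clinear_on UNIV f" "\<And>s. s \<in> Y \<Longrightarrow> f s = 0" "\<And>x. cmod (f x) \<le> 1 * norm x"
          "\<And>d. (\<And>s. s \<in> Y \<Longrightarrow> d \<le> Re 0 + 1 * norm (x - s)) \<Longrightarrow> d \<le> Re (f x)"
        by (rule Hahn_Banach_complex[OF Y(1), where B=1 and v=x]) auto
      have fD: "f \<in> ?D" using f(1,3) by (rule dual_spaceI)
      have "d \<le> Re (f x)" using d(2) by (intro f(4)) (force simp: dist_norm)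
      moreover have "f x = 0"
        using annihilates[OF fD f(2)] fD eq by (simp add: canonical_embedding_def)
      ultimately show False using d(1) by simp
    qed
    moreover have "y'' = canonical_embedding Y norm x"
    proof
      fix g show "y'' g = canonical_embedding Y norm x g"
      proof (cases "g \<in> dual_space Y norm")
        case True
        then have g: "clinear_on Y g" "\<And>y. y \<notin> Y \<Longrightarrow> g y = 0" by (auto simp: dual_space_def)
        obtain f where f: "clinear_on UNIV f" "\<And>s. s \<in> Y \<Longrightarrow> f s = g s"
            "\<And>x. cmod (f x) \<le> dual_norm Y norm g * norm x"
          by (rule Hahn_Banach_complex[OF Y(1) g(1), where v=0],
              rule dual_norm_bound[OF hY True], assumption, rule dual_norm_nonneg[OF hY True], rule that)
        have fD: "f \<in> ?D" using f(1,3) by (rule dual_spaceI)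
        have "res f = g" using f(2) g(2) by (auto simp: res_def)
        moreover have "y'' (res f) = f x"
          using fun_cong[OF eq, of f] fD by (simp add: \<phi>_def canonical_embedding_def)
        ultimately have "y'' g = f x" by simp
        then show ?thesis using True f(2)[OF \<open>x \<in> Y\<close>] by (simp add: canonical_embedding_def)
      qed (simp add: y''0 canonical_embedding_def)
    qed
    ultimately show False using y''(2) by blast
  qed
  then show ?thesis using that[OF \<phi> _ annihilates] by blast
qed

text \<open>The bidual is left behind here: later steps only see functionals \<open>f\<close> of
  norm at most one, expressed by \<open>cmod (f u) \<le> norm u\<close>. The last clause is the norm
  identity of the L-projection for \<open>e + \<alpha> \<psi>\<close>, with the supremum defining
  the bidual norm replaced by a nearly optimal \<open>f\<close>.\<close>

lemma L_embedded_singular_functional: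
  fixes Y :: "'a::complex_normed_vector set"
  assumes L: "L_embedded (UNIV :: 'a set)"
    and Y: "csubspace Y" "closed Y" "\<not> reflexive_space Y"
  obtains x \<psi> where "clinear_on (dual_space UNIV norm) \<psi>"
    "\<And>f. f \<in> dual_space UNIV norm \<Longrightarrow> (\<And>u. cmod (f u) \<le> norm u) \<Longrightarrow> cmod (\<psi> f) \<le> 1"
    "\<And>g. g \<in> dual_space UNIV norm \<Longrightarrow> (\<And>y. y \<in> Y \<Longrightarrow> g y = 0) \<Longrightarrow> \<psi> g = - g x"
    "\<And>e \<alpha> \<epsilon>. \<epsilon> > 0 \<Longrightarrow> \<exists>f\<in>dual_space UNIV norm. (\<forall>u. cmod (f u) \<le> norm u) \<and>
      norm e + cmod \<alpha> - \<epsilon> < cmod (f e + \<alpha> * \<psi> f)"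
proof -
  let ?D = "dual_space (UNIV :: 'a set) norm" and ?B = "bidual_space (UNIV :: 'a set) norm"
  let ?n = "bidual_norm (UNIV :: 'a set) norm" and ?can = "canonical_embedding (UNIV :: 'a set) norm"
  have h: "homogeneous_on (UNIV :: 'a set) norm" by (simp add: homogeneous_on_norm complex_vector.subspace_UNIV)
  have hD: "homogeneous_on ?D (dual_norm UNIV norm)" by (rule homogeneous_on_dual[OF h])
  have hB: "homogeneous_on ?B ?n"
    using homogeneous_on_dual[OF hD] by (simp add: bidual_space_def bidual_norm_def[abs_def])
  have B: "csubspace ?B" using hB by (simp add: homogeneous_on_def)
  have canB: "?can e \<in> ?B" for e by (rule canonical_embedding_in_bidual[OF h]) simp
  obtain P where P: "L_projection ?B ?n P" "P ` ?B = range ?can"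
    using L by (auto simp: L_embedded_def)
  have Plin: "clinear_on ?B P" and PP: "\<And>z. z \<in> ?B \<Longrightarrow> P (P z) = P z" and PB: "\<And>z. z \<in> ?B \<Longrightarrow> P z \<in> ?B"
    and Pn: "\<And>z. z \<in> ?B \<Longrightarrow> ?n z = ?n (P z) + ?n (z - P z)"
    using P(1) unfolding L_projection_def by blast+
  obtain \<phi> where \<phi>: "\<phi> \<in> ?B" "\<phi> \<notin> range ?can"
    "\<And>g. g \<in> ?D \<Longrightarrow> (\<And>y. y \<in> Y \<Longrightarrow> g y = 0) \<Longrightarrow> \<phi> g = 0"
    using bidual_functional_of_subspace[OF Y] by blast
  obtain x where x: "P \<phi> = ?can x" using P(2) \<phi>(1) by blast
  define \<psi> where "\<psi> = \<phi> - P \<phi>"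
  have \<psi>B: "\<psi> \<in> ?B" unfolding \<psi>_def using B \<phi>(1) PB by (intro complex_vector.subspace_diff) auto
  have P\<psi>: "P \<psi> = 0"
    unfolding \<psi>_def using clinear_on_diff[OF B Plin \<phi>(1) PB[OF \<phi>(1)]] PP[OF \<phi>(1)] by simp
  have lin: "clinear_on ?D \<psi>" and \<psi>0: "\<And>f. f \<notin> ?D \<Longrightarrow> \<psi> f = 0"
    using \<psi>B by (auto simp: bidual_space_def dual_space_def[of ?D])
  have bound: "cmod (z f) \<le> ?n z * dual_norm UNIV norm f" if "z \<in> ?B" "f \<in> ?D" for z f
    using dual_norm_bound[OF hD _ that(2), of z] that(1) by (simp add: bidual_space_def bidual_norm_def)
  define b where "b = ?n \<psi>"
  have "b \<ge> 0" using hB \<psi>B by (simp add: homogeneous_on_def b_def)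
  moreover have "b \<noteq> 0"
  proof
    assume "b = 0"
    then have "\<psi> f = 0" for f
      using bound[OF \<psi>B, of f] \<psi>0[of f] by (cases "f \<in> ?D") (auto simp: b_def)
    then have "\<phi> = ?can x" using x by (auto simp: \<psi>_def fun_eq_iff)
    then show False using \<phi>(2) by blast
  qed
  ultimately have b: "b > 0" by simp
  \<comment> \<open>Scaling by \<open>c\<close> gives the singular part norm one. The translate is
    scaled with it, so the vector returned is \<open>c *\<^sub>C x\<close>.\<close>
  define c where "c = complex_of_real (inverse b)"
  show ?thesis
  proof
    show "clinear_on ?D (c *\<^sub>C \<psi>)"
      using lin by (auto simp: clinear_on_def scaleC_fun_def scaleC_complex_def algebra_simps)
    show "cmod ((c *\<^sub>C \<psi>) f) \<le> 1" if f: "f \<in> ?D" "\<And>u. cmod (f u) \<le> norm u" for f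
    proof -
      have "dual_norm UNIV norm f \<le> 1" using f(2) by (intro dual_norm_le[OF h]) auto
      then have "b * dual_norm UNIV norm f \<le> b" using b by (simp add: mult_left_le)
      then have "cmod (\<psi> f) \<le> b" using bound[OF \<psi>B f(1)] by (simp add: b_def)
      then have "inverse b * cmod (\<psi> f) \<le> 1" using b by (simp add: field_simps)
      then show ?thesis using b
        by (simp only: scaleC_fun_def scaleC_complex_def c_def norm_mult norm_of_real) simp
    qed
    show "(c *\<^sub>C \<psi>) g = - g (c *\<^sub>C x)" if g: "g \<in> ?D" "\<And>y. y \<in> Y \<Longrightarrow> g y = 0" for g
    proof -
      have "g (c *\<^sub>C x) = c * g x" using g(1) by (simp add: dual_space_def clinear_on_def scaleC_complex_def)
      then show ?thesis
        using \<phi>(3)[OF g] x g(1) by (simp add: \<psi>_def scaleC_fun_def scaleC_complex_def canonical_embedding_def)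
    qed
    fix e :: 'a and \<alpha> :: complex and \<epsilon> :: real assume \<epsilon>: "\<epsilon> > 0"
    let ?s = "\<alpha> *\<^sub>C c *\<^sub>C \<psi>"
    have sB: "?s \<in> ?B" "?can e + ?s \<in> ?B"
      using B canB \<psi>B by (auto intro!: complex_vector.subspace_add complex_vector.subspace_scale)
    \<comment> \<open>A projection fixes its range and sends the singular part to 0. Hence
      \<open>?can e\<close> and \<open>?s\<close> are the two components of their sum, and the norm
      is additive on them.\<close>
    have "?can e \<in> P ` ?B" unfolding P(2) by simp
    then have "P (?can e) = ?can e" using PP by auto
    moreover have "P ?s = 0"
      using \<psi>B P\<psi> clinear_on_scale[OF Plin, of \<psi> "\<alpha> * c"] by (simp add: scaleC_scaleC)
    ultimately have "P (?can e + ?s) = ?can e"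
      using clinear_on_add[OF Plin canB sB(1)] by simp
    then have "?n (?can e + ?s) = ?n (?can e) + ?n ?s" using Pn[OF sB(2)] by simp
    moreover have "?n ?s = cmod \<alpha>"
    proof -
      have "?n ((\<alpha> * c) *\<^sub>C \<psi>) = cmod (\<alpha> * c) * ?n \<psi>" using hB \<psi>B by (simp add: homogeneous_on_def)
      then show ?thesis using b by (simp add: scaleC_scaleC norm_mult c_def norm_inverse b_def)
    qed
    ultimately have "norm e + cmod \<alpha> - \<epsilon> < ?n (?can e + ?s)"
      using norm_le_bidual_norm_canonical_embedding[of e] \<epsilon> by simp
    then have less: "norm e + cmod \<alpha> - \<epsilon> < dual_norm ?D (dual_norm UNIV norm) (?can e + ?s)"
      by (simp add: bidual_norm_def)
    have "?can e + ?s \<in> dual_space ?D (dual_norm UNIV norm)"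
      using sB(2) by (simp add: bidual_space_def)
    then obtain f where f: "f \<in> ?D" "dual_norm UNIV norm f \<le> 1" "norm e + cmod \<alpha> - \<epsilon> < cmod ((?can e + ?s) f)"
      using less by (rule dual_norm_approx[OF hD])
    have "cmod (f u) \<le> norm u" for u
      using dual_norm_bound[OF h f(1), of u] f(2) mult_right_mono[of "dual_norm UNIV norm f" 1 "norm u"] by simp
    then show "\<exists>f\<in>?D. (\<forall>u. cmod (f u) \<le> norm u) \<and> norm e + cmod \<alpha> - \<epsilon> < cmod (f e + \<alpha> * (c *\<^sub>C \<psi>) f)"
      using f(1,3) by (intro bexI[of _ f]) (auto simp: canonical_embedding_def scaleC_fun_def scaleC_complex_def)
  qed
qed

section \<open>Asymptotic copies of $\ell^1$\<close>

text \<open>Evaluation at \<open>y\<close> is to reproduce \<phi> not only on \<open>F\<close> but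
  on every functional whose restriction to \<open>Y\<close> vanishes on the common zeros of
  \<open>F\<close>, that is, depends linearly on \<open>F\<close> there. The induction needs this
  stronger form, and so does the later correction of the norm.\<close>

lemma interpolate_functionals:
  fixes Y :: "'a::complex_normed_vector set"
  assumes Y: "csubspace Y" and lin: "clinear_on (dual_space UNIV norm) \<phi>"
    and ann: "\<And>g. g \<in> dual_space UNIV norm \<Longrightarrow> (\<And>y. y \<in> Y \<Longrightarrow> g y = 0) \<Longrightarrow> \<phi> g = 0"
    and "finite F" "F \<subseteq> dual_space UNIV norm"
  shows "\<exists>y\<in>Y. \<forall>g\<in>dual_space UNIV norm.
    (\<forall>u\<in>Y. (\<forall>f\<in>F. f u = 0) \<longrightarrow> g u = 0) \<longrightarrow> \<phi> g = g y"
  using assms(4,5)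
proof (induction F rule: finite_induct)
  case empty
  have "0 \<in> Y" using Y by (rule complex_vector.subspace_0)
  moreover have "g 0 = 0" if "g \<in> dual_space UNIV norm" for g :: "'a \<Rightarrow> complex"
    using that clinear_on_scale[of UNIV g 0 0] by (simp add: dual_space_def scaleC_complex_def)
  ultimately show ?case using ann by (intro bexI[of _ 0]) auto
next
  case (insert h F)
  let ?D = "dual_space (UNIV :: 'a set) norm"
  have D: "csubspace ?D" by (rule csubspace_dual_space)
  have add: "g (u + v) = g u + g v" and scale: "g (c *\<^sub>C u) = c * g u"
    and diff: "g (u - v) = g u - g v" if "g \<in> ?D" for g u v c
    using that clinear_on_diff[of UNIV g u v]
    by (auto simp: dual_space_def clinear_on_def scaleC_complex_def)
  have hD: "h \<in> ?D" and FD: "F \<subseteq> ?D" using insert.prems by auto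
  obtain y where y: "y \<in> Y"
    "\<forall>g\<in>?D. (\<forall>u\<in>Y. (\<forall>f\<in>F. f u = 0) \<longrightarrow> g u = 0) \<longrightarrow> \<phi> g = g y"
    using insert.IH[OF FD] by (rule bexE)
  show ?case
  proof (cases "\<forall>u\<in>Y. (\<forall>f\<in>F. f u = 0) \<longrightarrow> h u = 0")
    case True
    then have "\<forall>u\<in>Y. (\<forall>f\<in>insert h F. f u = 0) \<longleftrightarrow> (\<forall>f\<in>F. f u = 0)" by blast
    then show ?thesis using y by (intro bexI[of _ y]) simp_all
  next
    case False
    then obtain u0 where u0: "u0 \<in> Y" "\<And>f. f \<in> F \<Longrightarrow> f u0 = 0" "h u0 \<noteq> 0" by blast
    define u where "u = inverse (h u0) *\<^sub>C u0"
    have u: "u \<in> Y" "\<And>f. f \<in> F \<Longrightarrow> f u = 0" "h u = 1"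
      using u0 FD hD by (auto simp: u_def scale subsetD complex_vector.subspace_scale[OF Y])
    \<comment> \<open>Moving along \<open>u\<close> leaves the values of all members of
      \<open>F\<close> unchanged and corrects the value of \<open>h\<close>.\<close>
    let ?y = "y + (\<phi> h - h y) *\<^sub>C u"
    have "\<phi> g = g ?y" if g: "g \<in> ?D" and vanish: "\<forall>v\<in>Y. (\<forall>f\<in>insert h F. f v = 0) \<longrightarrow> g v = 0" for g
    proof -
      \<comment> \<open>Subtracting a multiple of \<open>h\<close> makes the functional vanish at
        \<open>u\<close>. For a common zero \<open>v\<close> of \<open>F\<close> in
        \<open>Y\<close>, the vector \<open>v - h v *\<^sub>C u\<close> is also a zero of
        \<open>h\<close>, so the induction hypothesis applies to \<open>?k\<close>.\<close>
      let ?k = "g - g u *\<^sub>C h"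
      have k: "?k \<in> ?D"
        using D g hD by (intro complex_vector.subspace_diff complex_vector.subspace_scale)
      have "?k v = 0" if v: "v \<in> Y" "\<And>f. f \<in> F \<Longrightarrow> f v = 0" for v
      proof -
        have "v - h v *\<^sub>C u \<in> Y"
          using v(1) u(1) Y by (intro complex_vector.subspace_diff complex_vector.subspace_scale)
        moreover have "f (v - h v *\<^sub>C u) = 0" if "f \<in> insert h F" for f
        proof -
          have fD: "f \<in> ?D" using that FD hD by blast
          show ?thesis
          proof (cases "f = h")
            case True
            then show ?thesis by (simp add: diff[OF hD] scale[OF hD] u(3))
          next
            case False
            then have "f u = 0" "f v = 0" using that u(2)[of f] v(2)[of f] by blast+
            then show ?thesis by (simp add: diff[OF fD] scale[OF fD])
          qed
        qed
        ultimately have "g (v - h v *\<^sub>C u) = 0" using vanish by blast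
        then show ?thesis by (simp add: diff[OF g] scale[OF g] scaleC_fun_def scaleC_complex_def)
      qed
      then have "\<phi> ?k = ?k y" by (intro mp[OF bspec[OF y(2) k]]) blast
      moreover have "\<phi> ?k = \<phi> g - g u * \<phi> h"
        using clinear_on_diff[OF D lin g complex_vector.subspace_scale[OF D hD]]
          clinear_on_scale[OF lin hD] by (simp add: scaleC_complex_def)
      moreover have "?k y = g y - g u * h y" by (simp add: scaleC_fun_def scaleC_complex_def)
      ultimately show ?thesis unfolding add[OF g] scale[OF g] by (simp add: algebra_simps)
    qed
    moreover have "?y \<in> Y"
      using y(1) u(1) Y by (intro complex_vector.subspace_add complex_vector.subspace_scale)
    ultimately show ?thesis by blast
  qed
qed

text \<open>Adding evaluation at \<open>x\<close> to \<psi> gives a functional that kills the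
  annihilator of \<open>Y\<close>, so it can be interpolated by some \<open>y\<close> in
  \<open>Y\<close>. Then \<open>y - x\<close> has the right values on \<open>F\<close>, and it
  remains to lower its norm by a vector \<open>l\<close> from the common zeros \<open>L\<close> of
  \<open>F\<close> in \<open>Y\<close>, which leaves these values alone.\<close>

lemma Helly_translate:
  fixes Y :: "'a::complex_normed_vector set"
  assumes Y: "csubspace Y" and lin: "clinear_on (dual_space UNIV norm) \<psi>"
    and contr: "\<And>f. f \<in> dual_space UNIV norm \<Longrightarrow> (\<And>u. cmod (f u) \<le> norm u) \<Longrightarrow> cmod (\<psi> f) \<le> 1"
    and ann: "\<And>g. g \<in> dual_space UNIV norm \<Longrightarrow> (\<And>y. y \<in> Y \<Longrightarrow> g y = 0) \<Longrightarrow> \<psi> g = - g x"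
    and F: "finite F" "F \<subseteq> dual_space UNIV norm" and \<epsilon>: "\<epsilon> > 0"
  obtains z where "z + x \<in> Y" "norm z \<le> 1 + \<epsilon>" "\<And>f. f \<in> F \<Longrightarrow> f z = \<psi> f"
proof -
  let ?D = "dual_space (UNIV :: 'a set) norm"
  have add: "g (u + v) = g u + g v" and scale: "g (c *\<^sub>C u) = c * g u"
    and diff: "g (u - v) = g u - g v" if "g \<in> ?D" for g u v c
    using that clinear_on_diff[of UNIV g u v]
    by (auto simp: dual_space_def clinear_on_def scaleC_complex_def)
  define \<phi> where "\<phi> = (\<lambda>f. \<psi> f + f x)"
  have "clinear_on ?D \<phi>"
    using lin by (auto simp: clinear_on_def \<phi>_def scaleC_fun_def scaleC_complex_def algebra_simps)
  moreover have "\<phi> g = 0" if "g \<in> ?D" "\<And>y. y \<in> Y \<Longrightarrow> g y = 0" for g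
    using ann[OF that] by (simp add: \<phi>_def)
  ultimately have "\<exists>y\<in>Y. \<forall>g\<in>?D. (\<forall>u\<in>Y. (\<forall>f\<in>F. f u = 0) \<longrightarrow> g u = 0) \<longrightarrow> \<phi> g = g y"
    by (rule interpolate_functionals[OF Y _ _ F])
  then obtain y where y: "y \<in> Y"
    "\<forall>g\<in>?D. (\<forall>u\<in>Y. (\<forall>f\<in>F. f u = 0) \<longrightarrow> g u = 0) \<longrightarrow> \<phi> g = g y"
    by (rule bexE)
  define L where "L = {u \<in> Y. \<forall>f\<in>F. f u = 0}"
  have L: "csubspace L"
  proof (rule complex_vector.subspaceI)
    have "f 0 = 0" if "f \<in> ?D" for f using diff[OF that, of 0 0] by simp
    then show "0 \<in> L" using Y F by (auto simp: L_def complex_vector.subspace_0)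
  qed (use Y F in \<open>auto simp: L_def add scale subsetD complex_vector.subspace_add complex_vector.subspace_scale\<close>)
  have "\<exists>l\<in>L. norm (y - x - l) \<le> 1 + \<epsilon>"
  proof (rule ccontr)
    \<comment> \<open>If no correction worked, a functional of norm at most one vanishing on
      \<open>L\<close> would have real part at least \<open>1 + \<epsilon>\<close> at
      \<open>y - x\<close>. As it vanishes on \<open>L\<close>, the interpolation covers it although
      it need not belong to \<open>F\<close>, and this value is its image under \<psi>, of modulus
      at most one.\<close>
    assume far: "\<not> ?thesis"
    have "clinear_on L (\<lambda>_. 0::complex)" by (simp add: clinear_on_def)
    then obtain f where f: "clinear_on UNIV f" "\<And>s. s \<in> L \<Longrightarrow> f s = 0" "\<And>x. cmod (f x) \<le> 1 * norm x"
        "\<And>d. (\<And>s. s \<in> L \<Longrightarrow> d \<le> Re 0 + 1 * norm (y - x - s)) \<Longrightarrow> d \<le> Re (f (y - x))"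
      by (rule Hahn_Banach_complex[OF L, where B=1 and v="y - x"]) auto
    have fD: "f \<in> ?D" using f(1,3) by (rule dual_spaceI)
    have "\<phi> f = f y" using f(2) by (intro mp[OF bspec[OF y(2) fD]]) (simp add: L_def)
    then have "\<psi> f = f (y - x)"
      unfolding \<phi>_def diff[OF fD] by (simp only: eq_diff_eq)
    moreover have "1 + \<epsilon> \<le> Re (f (y - x))" by (rule f(4)) (use far in force)
    moreover have "cmod (\<psi> f) \<le> 1" using f(3) by (intro contr[OF fD]) simp
    ultimately show False using complex_Re_le_cmod[of "\<psi> f"] \<epsilon> by simp
  qed
  then obtain l where l: "l \<in> L" "norm (y - x - l) \<le> 1 + \<epsilon>" by blast
  show ?thesis
  proof (rule that)
    show "y - x - l + x \<in> Y"
      using y(1) l(1) complex_vector.subspace_diff[OF Y, of y l] by (simp add: L_def algebra_simps)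
    fix f assume f: "f \<in> F"
    then have fD: "f \<in> ?D" using F by blast
    have "\<phi> f = f y" using f by (intro mp[OF bspec[OF y(2) fD]]) simp
    then have "\<psi> f = f y - f x" by (simp only: \<phi>_def eq_diff_eq)
    then show "f (y - x - l) = \<psi> f" using l(1) f by (simp add: diff[OF fD] L_def)
  qed (fact l(2))
qed

section \<open>Inductive construction of an almost isometric sequence\<close>

text \<open>For each point of a finite net in \<open>K\<close> a nearly norming functional is
  chosen. A vector \<open>z\<close> that agrees with \<psi> on these functionals inherits the norm
  additivity at the net points, and the remaining pairs are reached by perturbation.\<close>

lemma singular_step_compact:
  fixes Y :: "'a::complex_normed_vector set"
  assumes helly: "\<And>F \<epsilon>. finite F \<Longrightarrow> F \<subseteq> dual_space UNIV norm \<Longrightarrow> \<epsilon> > 0 \<Longrightarrow>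
      \<exists>z. z + x \<in> Y \<and> norm z \<le> 1 + \<epsilon> \<and> (\<forall>f\<in>F. f z = \<psi> f)"
    and singular: "\<And>e \<alpha> \<epsilon>. \<epsilon> > 0 \<Longrightarrow> \<exists>f\<in>dual_space UNIV norm. (\<forall>u. cmod (f u) \<le> norm u) \<and>
      norm e + cmod \<alpha> - \<epsilon> < cmod (f e + \<alpha> * \<psi> f)"
    and K: "compact K" and \<epsilon>: "\<epsilon> > 0"
  obtains z where "z + x \<in> Y" "norm z \<le> 1 + \<epsilon>"
    "\<And>e \<alpha>. (e, \<alpha>) \<in> K \<Longrightarrow> norm e + cmod \<alpha> - \<epsilon> \<le> norm (e + \<alpha> *\<^sub>C z)"
proof -
  \<comment> \<open>The six units of error: two from replacing \<open>norm e\<close> and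
    \<open>cmod \<alpha>\<close> by their values at the net point, one from the norming functional,
    one from moving the vector and two from moving the scalar, since \<open>\<eta> \<le> 1\<close>
    gives \<open>norm z \<le> 2\<close>.\<close>
  define \<eta> where "\<eta> = min 1 (\<epsilon> / 6)"
  have \<eta>: "\<eta> > 0" "\<eta> \<le> 1" "6 * \<eta> \<le> \<epsilon>" using \<epsilon> by (auto simp: \<eta>_def)
  obtain T where T: "finite T" "K \<subseteq> (\<Union>p\<in>T. ball p \<eta>)"
    using K \<eta>(1) unfolding compact_eq_totally_bounded by blast
  have "\<exists>f\<in>dual_space UNIV norm. (\<forall>u. cmod (f u) \<le> norm u) \<and>
      norm (fst p) + cmod (snd p) - \<eta> < cmod (f (fst p) + snd p * \<psi> f)" for p :: "'a \<times> complex"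
    by (rule singular[OF \<eta>(1)])
  then obtain g where g: "\<And>p. g p \<in> dual_space UNIV norm" "\<And>p u. cmod (g p u) \<le> norm u"
      "\<And>p. norm (fst p) + cmod (snd p) - \<eta> < cmod (g p (fst p) + snd p * \<psi> (g p))"
    by metis
  have "g ` T \<subseteq> dual_space UNIV norm" using g(1) by blast
  then obtain z where z': "z + x \<in> Y" "norm z \<le> 1 + \<eta>" "\<forall>f\<in>g ` T. f z = \<psi> f"
    using helly[OF finite_imageI[OF T(1)] _ \<eta>(1), of g] by blast
  have z: "z + x \<in> Y" "norm z \<le> 1 + \<eta>" "\<And>p. p \<in> T \<Longrightarrow> g p z = \<psi> (g p)"
    using z' by blast+
  show ?thesis
  proof (rule that)
    show "z + x \<in> Y" by (fact z(1))
    show "norm z \<le> 1 + \<epsilon>" using z(2) \<eta> by simp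
    fix e \<alpha> assume "(e, \<alpha>) \<in> K"
    then obtain p where p: "p \<in> T" "dist p (e, \<alpha>) < \<eta>" using T(2) by auto
    obtain e' \<alpha>' where p_eq: "p = (e', \<alpha>')" by fastforce
    have close: "norm (e' - e) \<le> \<eta>" "cmod (\<alpha>' - \<alpha>) \<le> \<eta>"
      using p(2) dist_fst_le[of p "(e, \<alpha>)"] dist_snd_le[of p "(e, \<alpha>)"] by (auto simp: p_eq dist_norm)
    have "g p (e' + \<alpha>' *\<^sub>C z) = g p e' + \<alpha>' * \<psi> (g p)"
      using g(1)[of p] z(3)[OF p(1)] by (simp add: dual_space_def clinear_on_def scaleC_complex_def)
    then have 1: "norm e' + cmod \<alpha>' - \<eta> < norm (e' + \<alpha>' *\<^sub>C z)"
      using g(3)[of p] g(2)[of p "e' + \<alpha>' *\<^sub>C z"] by (simp add: p_eq)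
    have "e' + \<alpha>' *\<^sub>C z = (e + \<alpha> *\<^sub>C z) + ((e' - e) + (\<alpha>' - \<alpha>) *\<^sub>C z)"
      using scaleC_add_left[of "\<alpha>' - \<alpha>" \<alpha> z] by (simp add: algebra_simps)
    then have "norm (e' + \<alpha>' *\<^sub>C z) \<le> norm (e + \<alpha> *\<^sub>C z) + norm ((e' - e) + (\<alpha>' - \<alpha>) *\<^sub>C z)"
      by (simp only: norm_triangle_ineq)
    moreover have "norm ((e' - e) + (\<alpha>' - \<alpha>) *\<^sub>C z) \<le> norm (e' - e) + cmod (\<alpha>' - \<alpha>) * norm z"
      using norm_triangle_ineq[of "e' - e" "(\<alpha>' - \<alpha>) *\<^sub>C z"] by (simp add: norm_scaleC)
    moreover have "cmod (\<alpha>' - \<alpha>) * norm z \<le> \<eta> * 2"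
      using close z(2) \<eta> by (intro mult_mono) auto
    moreover have "norm e \<le> norm e' + \<eta>" "cmod \<alpha> \<le> cmod \<alpha>' + \<eta>"
      using close norm_triangle_sub[of e e'] norm_triangle_sub[of \<alpha> \<alpha>'] by (auto simp: norm_minus_commute)
    ultimately show "norm e + cmod \<alpha> - \<epsilon> \<le> norm (e + \<alpha> *\<^sub>C z)"
      using 1 close(1) \<eta>(3) by linarith
  qed
qed

lemma continuous_on_scaleC:
  fixes z :: "'a::complex_normed_vector"
  assumes "continuous_on S f"
  shows "continuous_on S (\<lambda>s. f s *\<^sub>C z)"
proof -
  have "f s *\<^sub>C z = Re (f s) *\<^sub>R z + Im (f s) *\<^sub>R (\<i> *\<^sub>C z)" for s
    unfolding scaleR_scaleC scaleC_scaleC scaleC_add_left[symmetric]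
    by (rule arg_cong[where f="\<lambda>c. c *\<^sub>C z"]) (simp add: complex_eq_iff)
  then show ?thesis
    using assms by (auto intro!: continuous_intros)
qed

text \<open>Each further vector turns the set into the continuous image of its product with a closed
  disc.\<close>

lemma compact_bounded_combinations:
  fixes z :: "nat \<Rightarrow> 'a::complex_normed_vector"
  shows "compact {\<Sum>i<n. a i *\<^sub>C z i |a. \<forall>i. cmod (a i) \<le> 1}" (is "compact (?E n)")
proof (induction n)
  case 0
  have "?E 0 = {0}" by (auto intro: exI[of _ "\<lambda>_. 0"])
  then show ?case by simp
next
  case (Suc n)
  have "?E (Suc n) = (\<lambda>(e, c). e + c *\<^sub>C z n) ` (?E n \<times> cball 0 1)"
  proof (intro equalityI subsetI)
    fix v assume "v \<in> ?E (Suc n)"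
    then obtain a where a: "\<forall>i. cmod (a i) \<le> 1" "v = (\<Sum>i<Suc n. a i *\<^sub>C z i)" by blast
    then show "v \<in> (\<lambda>(e, c). e + c *\<^sub>C z n) ` (?E n \<times> cball 0 1)"
      by (intro image_eqI[of _ _ "(\<Sum>i<n. a i *\<^sub>C z i, a n)"]) auto
  next
    fix v assume "v \<in> (\<lambda>(e, c). e + c *\<^sub>C z n) ` (?E n \<times> cball 0 1)"
    then obtain a c where a: "\<forall>i. cmod (a i) \<le> 1" "cmod c \<le> 1"
      "v = (\<Sum>i<n. a i *\<^sub>C z i) + c *\<^sub>C z n" by auto
    then show "v \<in> ?E (Suc n)"
      by (auto intro!: exI[of _ "a(n := c)"])
  qed
  moreover have "continuous_on (?E n \<times> cball 0 1) (\<lambda>(e, c). e + c *\<^sub>C z n)"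
    unfolding case_prod_beta by (intro continuous_intros continuous_on_scaleC)
  ultimately show ?case
    using Suc.IH by (auto intro!: compact_continuous_image compact_Times)
qed

text \<open>By homogeneity it is enough to treat coefficients of total modulus one, and these lie in
  a compact set. Rescaling by the total modulus turns the additive error \<epsilon> into one
  proportional to that total.\<close>

lemma almost_l1_step:
  fixes Y :: "'a::complex_normed_vector set" and z :: "nat \<Rightarrow> 'a"
  assumes step: "\<And>K \<epsilon>. compact K \<Longrightarrow> \<epsilon> > 0 \<Longrightarrow> \<exists>z. z + x \<in> Y \<and> norm z \<le> 1 + \<epsilon> \<and>
      (\<forall>e \<alpha>. (e, \<alpha>) \<in> K \<longrightarrow> norm e + cmod \<alpha> - \<epsilon> \<le> norm (e + \<alpha> *\<^sub>C z))"
    and \<epsilon>: "\<epsilon> > 0"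
  shows "\<exists>r. r + x \<in> Y \<and> norm r \<le> 1 + \<epsilon> \<and>
    (\<forall>a \<alpha>. norm (\<Sum>i<n. a i *\<^sub>C z i) + cmod \<alpha> - \<epsilon> * ((\<Sum>i<n. cmod (a i)) + cmod \<alpha>)
      \<le> norm ((\<Sum>i<n. a i *\<^sub>C z i) + \<alpha> *\<^sub>C r))"
proof -
  define E where "E = {\<Sum>i<n. a i *\<^sub>C z i |a. \<forall>i. cmod (a i) \<le> 1}"
  have "compact (E \<times> cball (0::complex) 1)"
    unfolding E_def by (intro compact_Times compact_bounded_combinations compact_cball)
  then obtain r where r: "r + x \<in> Y" "norm r \<le> 1 + \<epsilon>"
    "\<forall>e \<alpha>. (e, \<alpha>) \<in> E \<times> cball 0 1 \<longrightarrow> norm e + cmod \<alpha> - \<epsilon> \<le> norm (e + \<alpha> *\<^sub>C r)"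
    using step[OF _ \<epsilon>] by blast
  have "norm (\<Sum>i<n. a i *\<^sub>C z i) + cmod \<alpha> - \<epsilon> * ((\<Sum>i<n. cmod (a i)) + cmod \<alpha>)
      \<le> norm ((\<Sum>i<n. a i *\<^sub>C z i) + \<alpha> *\<^sub>C r)" for a \<alpha>
  proof -
    define s where "s = (\<Sum>i<n. cmod (a i)) + cmod \<alpha>"
    have s0: "s \<ge> 0" by (auto simp: s_def intro!: add_nonneg_nonneg sum_nonneg)
    have \<alpha>s: "cmod \<alpha> \<le> s" by (auto simp: s_def intro!: sum_nonneg)
    have as: "cmod (a i) \<le> s" if "i < n" for i
      using member_le_sum[of i "{..<n}" "\<lambda>i. cmod (a i)"] that by (simp add: s_def add_increasing2)
    show ?thesis
    proof (cases "s = 0")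
      case True
      then have "\<alpha> = 0" using \<alpha>s by simp
      then show ?thesis using True by (simp add: s_def)
    next
      case False
      then have s: "s > 0" using s0 by simp
      define c where "c = complex_of_real (inverse s)"
      have c: "cmod c = inverse s" using s by (simp add: c_def norm_inverse)
      let ?v = "\<Sum>i<n. a i *\<^sub>C z i"
      \<comment> \<open>The value 0 from index \<open>n\<close> on is needed because membership in
        \<open>E\<close> bounds the coefficients at all indices.\<close>
      have "c *\<^sub>C ?v = (\<Sum>i<n. (if i < n then c * a i else 0) *\<^sub>C z i)"
        by (simp add: complex_vector.scale_sum_right scaleC_scaleC)
      moreover have "\<forall>i. cmod (if i < n then c * a i else 0) \<le> 1"
        using as s by (simp add: norm_mult c field_simps)
      ultimately have "c *\<^sub>C ?v \<in> E" unfolding E_def by (intro CollectI exI[of _ "\<lambda>i. if i < n then c * a i else 0"]) simp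
      moreover have "cmod (c * \<alpha>) \<le> 1" using \<alpha>s s by (simp add: norm_mult c field_simps)
      ultimately have "norm (c *\<^sub>C ?v) + cmod (c * \<alpha>) - \<epsilon> \<le> norm (c *\<^sub>C ?v + (c * \<alpha>) *\<^sub>C r)"
        using r(3) by simp
      moreover have "c *\<^sub>C ?v + (c * \<alpha>) *\<^sub>C r = c *\<^sub>C (?v + \<alpha> *\<^sub>C r)"
        by (simp add: scaleC_add_right scaleC_scaleC)
      ultimately have "norm (c *\<^sub>C ?v) + cmod (c * \<alpha>) - \<epsilon> \<le> norm (c *\<^sub>C (?v + \<alpha> *\<^sub>C r))"
        by (simp only:)
      then have "inverse s * (norm ?v + cmod \<alpha> - \<epsilon> * s) \<le> inverse s * norm (?v + \<alpha> *\<^sub>C r)"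
        using s unfolding norm_scaleC norm_mult c right_diff_distrib distrib_left
        by (simp add: mult.left_commute[of _ \<epsilon> s])
      then show ?thesis using s by (simp add: s_def)
    qed
  qed
  then show ?thesis using r(1,2) by blast
qed

text \<open>Step \<open>k\<close> has error \<open>(1/2) ^ (k + 2)\<close> and affects the
  coefficients with index at most \<open>k\<close>. The total loss at index \<open>i\<close> is
  therefore bounded by the sum of these errors over all \<open>k \<ge> i\<close>, which is
  \<open>(1/2) ^ Suc i\<close>.\<close>

lemma almost_l1_sequence:
  fixes Y :: "'a::complex_normed_vector set"
  assumes step: "\<And>K \<epsilon>. compact K \<Longrightarrow> \<epsilon> > 0 \<Longrightarrow> \<exists>z. z + x \<in> Y \<and> norm z \<le> 1 + \<epsilon> \<and>
      (\<forall>e \<alpha>. (e, \<alpha>) \<in> K \<longrightarrow> norm e + cmod \<alpha> - \<epsilon> \<le> norm (e + \<alpha> *\<^sub>C z))"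
  obtains z where "\<And>n. z n + x \<in> Y" "\<And>n. norm (z n) \<le> 1 + (1/2) ^ Suc n"
    "\<And>n a. (\<Sum>i<n. (1 - (1/2) ^ Suc i) * cmod (a i)) \<le> norm (\<Sum>i<n. a i *\<^sub>C z i)"
proof -
  define P where "P = (\<lambda>(z :: nat \<Rightarrow> 'a) n r. r + x \<in> Y \<and> norm r \<le> 1 + (1/2) ^ (n + 2) \<and>
    (\<forall>a \<alpha>. norm (\<Sum>i<n. a i *\<^sub>C z i) + cmod \<alpha> - (1/2) ^ (n + 2) * ((\<Sum>i<n. cmod (a i)) + cmod \<alpha>)
      \<le> norm ((\<Sum>i<n. a i *\<^sub>C z i) + \<alpha> *\<^sub>C r)))"
  have "\<exists>z. \<forall>n. P z n (z n)"
  \<comment> \<open>\<open>P z n\<close> reads \<open>z\<close> only below \<open>n\<close>, which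
    makes the recursive choice legitimate.\<close>
  proof (rule dependent_wellorder_choice)
    fix r :: 'a and f g :: "nat \<Rightarrow> 'a" and n assume "\<And>i. i < n \<Longrightarrow> f i = g i"
    then have "(\<Sum>i<n. a i *\<^sub>C f i) = (\<Sum>i<n. a i *\<^sub>C g i)" for a by simp
    then show "P f n r = P g n r" by (simp add: P_def)
  next
    show "\<exists>r. P f n r" for f n
      unfolding P_def by (rule almost_l1_step[OF step]) simp_all
  qed
  then obtain z where z: "\<And>n. P z n (z n)" by blast
  \<comment> \<open>The telescoping term \<open>(1/2) ^ Suc n\<close> absorbs the error \<open>(1/2) ^ (n + 2)\<close> of every step.\<close>
  have inv: "(\<Sum>i<n. (1 - (1/2) ^ Suc i + (1/2) ^ Suc n) * cmod (a i)) \<le> norm (\<Sum>i<n. a i *\<^sub>C z i)" for n a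
  proof (induction n)
    case (Suc n)
    let ?A = "\<Sum>i<n. cmod (a i)" and ?B = "\<Sum>i<n. (1 - (1/2) ^ Suc i) * cmod (a i)"
    have split: "(\<Sum>i<n. (1 - (1/2) ^ Suc i + c) * cmod (a i)) = ?B + c * ?A" for c :: real
      by (simp add: distrib_right sum.distrib sum_distrib_left)
    have "(\<Sum>i<Suc n. (1 - (1/2) ^ Suc i + (1/2) ^ Suc (Suc n)) * cmod (a i))
        = ?B + (1/2) ^ Suc (Suc n) * ?A + (1 - (1/2) ^ Suc (Suc n)) * cmod (a n)"
      unfolding sum.lessThan_Suc split by simp
    also have "\<dots> = (?B + (1/2) ^ Suc n * ?A) + cmod (a n) - (1/2) ^ (n + 2) * (?A + cmod (a n))"
    proof -
      define e :: real where "e = (1/2) ^ (n + 2)"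
      have "(1/2) ^ Suc n = 2 * e" "(1/2) ^ Suc (Suc n) = e" by (auto simp: e_def)
      then show ?thesis unfolding e_def[symmetric] by (simp only:) (simp add: algebra_simps)
    qed
    also have "\<dots> \<le> norm (\<Sum>i<n. a i *\<^sub>C z i) + cmod (a n) - (1/2) ^ (n + 2) * (?A + cmod (a n))"
      using Suc.IH unfolding split by simp
    also have "\<dots> \<le> norm (\<Sum>i<Suc n. a i *\<^sub>C z i)" using z[of n] by (simp add: P_def)
    finally show ?case .
  qed simp
  show ?thesis
  proof
    show "z n + x \<in> Y" for n using z[of n] by (simp add: P_def)
    have "(1/2) ^ (n + 2) \<le> ((1/2) ^ Suc n :: real)" for n by (rule power_decreasing) auto
    then show "norm (z n) \<le> 1 + (1/2) ^ Suc n" for n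
      using z[of n] by (auto simp: P_def simp del: power_Suc intro: order.trans)
    show "(\<Sum>i<n. (1 - (1/2) ^ Suc i) * cmod (a i)) \<le> norm (\<Sum>i<n. a i *\<^sub>C z i)" for n a
      by (rule order.trans[OF sum_mono inv]) (auto intro: mult_right_mono)
  qed
qed

section \<open>Passage to differences\<close>

text \<open>The upper estimate is the triangle inequality. The lower one survives the limit of
  partial sums, since both sides converge.\<close>

lemma spans_l1_asymptotically_finite:
  fixes x :: "nat \<Rightarrow> 'a::{complex_normed_vector, banach}"
  assumes \<delta>: "\<And>n. \<delta> n \<in> {0..<1}" "\<delta> \<longlonglongrightarrow> 0" and le: "\<And>n. norm (x n) \<le> 1"
    and ge: "\<And>N \<alpha>. (\<Sum>n<N. (1 - \<delta> n) * cmod (\<alpha> n)) \<le> norm (\<Sum>n<N. \<alpha> n *\<^sub>C x n)"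
  shows "spans_l1_asymptotically x"
proof -
  have "x m \<noteq> 0" for m
  proof
    assume "x m = 0"
    then have "(\<Sum>n<Suc m. (1 - \<delta> n) * cmod (if n = m then 1 else 0)) \<le> 0"
      using ge[of "\<lambda>n. if n = m then 1 else 0" "Suc m"]
      by (simp add: if_distrib[of "\<lambda>c. c *\<^sub>C _"] sum.delta cong: if_cong)
    then show False using \<delta>(1)[of m] by simp
  qed
  moreover have "(\<Sum>n. (1 - \<delta> n) * cmod (\<alpha> n)) \<le> norm (\<Sum>n. \<alpha> n *\<^sub>C x n) \<and>
      norm (\<Sum>n. \<alpha> n *\<^sub>C x n) \<le> (\<Sum>n. cmod (\<alpha> n))" if \<alpha>: "summable (\<lambda>n. cmod (\<alpha> n))" for \<alpha>
  proof
    have bound: "norm (\<alpha> n *\<^sub>C x n) \<le> cmod (\<alpha> n)" for n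
      using mult_left_le[OF le[of n], of "cmod (\<alpha> n)"] by (simp add: norm_scaleC)
    have sn: "summable (\<lambda>n. norm (\<alpha> n *\<^sub>C x n))"
      by (rule summable_comparison_test'[OF \<alpha>]) (simp add: bound)
    have "norm (\<Sum>n. \<alpha> n *\<^sub>C x n) \<le> (\<Sum>n. norm (\<alpha> n *\<^sub>C x n))" by (rule summable_norm[OF sn])
    also have "\<dots> \<le> (\<Sum>n. cmod (\<alpha> n))" by (rule suminf_le[OF bound sn \<alpha>])
    finally show "norm (\<Sum>n. \<alpha> n *\<^sub>C x n) \<le> (\<Sum>n. cmod (\<alpha> n))" .
    have "summable (\<lambda>n. (1 - \<delta> n) * cmod (\<alpha> n))"
    proof (rule summable_comparison_test'[OF \<alpha>])
      show "norm ((1 - \<delta> n) * cmod (\<alpha> n)) \<le> cmod (\<alpha> n)" for n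
        using \<delta>(1)[of n] mult_right_mono[of "1 - \<delta> n" 1 "cmod (\<alpha> n)"] by (simp add: abs_mult)
    qed
    then have "(\<lambda>N. \<Sum>n<N. (1 - \<delta> n) * cmod (\<alpha> n)) \<longlonglongrightarrow> (\<Sum>n. (1 - \<delta> n) * cmod (\<alpha> n))"
      by (rule summable_LIMSEQ)
    moreover have "(\<lambda>N. norm (\<Sum>n<N. \<alpha> n *\<^sub>C x n)) \<longlonglongrightarrow> norm (\<Sum>n. \<alpha> n *\<^sub>C x n)"
      by (intro tendsto_norm summable_LIMSEQ summable_norm_cancel[OF sn])
    ultimately show "(\<Sum>n. (1 - \<delta> n) * cmod (\<alpha> n)) \<le> norm (\<Sum>n. \<alpha> n *\<^sub>C x n)"
      by (rule LIMSEQ_le) (use ge in blast)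
  qed
  ultimately show ?thesis using \<delta> unfolding spans_l1_asymptotically_def by blast
qed

lemma sum_pairs:
  fixes g :: "nat \<Rightarrow> 'a::comm_monoid_add"
  shows "(\<Sum>i<2 * N. g i) = (\<Sum>n<N. g (2 * n) + g (Suc (2 * n)))"
  by (induction N) (auto simp: add.assoc)

text \<open>A combination of the differences is a combination of the \<open>z i\<close> whose
  coefficients come in pairs of opposite sign, so each difference contributes twice its coefficient
  to the lower estimate, while its norm is at most about 2.\<close>

lemma spans_l1_asymptotically_differences:
  fixes z :: "nat \<Rightarrow> 'a::{complex_normed_vector, banach}"
  assumes le: "\<And>n. norm (z n) \<le> 1 + (1/2) ^ Suc n"
    and ge: "\<And>n a. (\<Sum>i<n. (1 - (1/2) ^ Suc i) * cmod (a i)) \<le> norm (\<Sum>i<n. a i *\<^sub>C z i)"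
  obtains c where "spans_l1_asymptotically (\<lambda>n. c n *\<^sub>C (z (2 * n) - z (Suc (2 * n))))"
proof -
  \<comment> \<open>The loss belonging to \<open>z (2 * n)\<close>; it dominates that of
    \<open>z (Suc (2 * n))\<close>, so one constant serves both members of a pair.\<close>
  define q :: "nat \<Rightarrow> real" where "q n = (1/2) ^ Suc (2 * n)" for n
  have q: "0 < q n" "q n \<le> 1/2" for n
    using power_le_one[of "1/2::real" "2 * n"] by (auto simp: q_def)
  have q': "(1/2) ^ Suc (Suc (2 * n)) \<le> q n" for n
    unfolding q_def by (rule power_decreasing) auto
  \<comment> \<open>Both norms in the pair are at most \<open>1 + q n\<close>, so this factor brings
    the difference into the unit ball. The lower constant becomes
    \<open>2 * c n * (1 - q n) = (1 - q n) / (1 + q n)\<close>, which determines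
    \<open>\<delta>\<close> below.\<close>
  define c :: "nat \<Rightarrow> real" where "c n = inverse (2 * (1 + q n))" for n
  have c: "c n > 0" for n using q(1)[of n] by (simp add: c_def)
  have "spans_l1_asymptotically (\<lambda>n. complex_of_real (c n) *\<^sub>C (z (2 * n) - z (Suc (2 * n))))"
  proof (rule spans_l1_asymptotically_finite[where \<delta>="\<lambda>n. 1 - (1 - q n) / (1 + q n)"])
    show "1 - (1 - q n) / (1 + q n) \<in> {0..<1}" for n using q[of n] by (auto simp: field_simps)
    have "q \<longlonglongrightarrow> 0"
      unfolding q_def using LIMSEQ_subseq_LIMSEQ[OF LIMSEQ_realpow_zero[of "1/2"], of "\<lambda>n. Suc (2 * n)"]
      by (auto simp: strict_mono_def o_def)
    then have "(\<lambda>n. 1 - (1 - q n) / (1 + q n)) \<longlonglongrightarrow> 1 - (1 - 0) / (1 + 0)"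
      by (intro tendsto_intros) auto
    then show "(\<lambda>n. 1 - (1 - q n) / (1 + q n)) \<longlonglongrightarrow> 0" by simp
    show "norm (complex_of_real (c n) *\<^sub>C (z (2 * n) - z (Suc (2 * n)))) \<le> 1" for n
    proof -
      have "norm (z (2 * n) - z (Suc (2 * n))) \<le> 2 * (1 + q n)"
      proof (rule norm_triangle_le_diff)
        have "norm (z (2 * n)) \<le> 1 + q n" "norm (z (Suc (2 * n))) \<le> 1 + q n"
          using le[of "2 * n"] order.trans[OF le add_left_mono[OF q'[of n]]] unfolding q_def by blast+
        then show "norm (z (2 * n)) + norm (z (Suc (2 * n))) \<le> 2 * (1 + q n)" by simp
      qed
      then have "c n * norm (z (2 * n) - z (Suc (2 * n))) \<le> c n * (2 * (1 + q n))"
        using c[of n] by (simp add: mult_left_mono)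
      moreover have "c n * (2 * (1 + q n)) = 1" using q(1)[of n] by (simp add: c_def)
      ultimately show ?thesis using c[of n] by (simp only: norm_scaleC norm_of_real abs_of_pos)
    qed
    fix N and \<alpha> :: "nat \<Rightarrow> complex"
    define a where "a i = (if even i then 1 else -1) * (\<alpha> (i div 2) * complex_of_real (c (i div 2)))" for i
    have "(\<Sum>n<N. (1 - (1 - (1 - q n) / (1 + q n))) * cmod (\<alpha> n))
        \<le> (\<Sum>n<N. (1 - (1/2) ^ Suc (2 * n)) * cmod (a (2 * n))
            + (1 - (1/2) ^ Suc (Suc (2 * n))) * cmod (a (Suc (2 * n))))"
    proof (rule sum_mono)
      fix n
      have "(1 - q n) / (1 + q n) = (1 - q n) * (2 * c n)"
        using q(1)[of n] by (simp add: c_def field_simps)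
      then have "(1 - (1 - (1 - q n) / (1 + q n))) * cmod (\<alpha> n) = (1 - q n) * (cmod (\<alpha> n) * c n) + (1 - q n) * (cmod (\<alpha> n) * c n)"
        by (simp only:) (simp add: algebra_simps)
      also have "\<dots> \<le> (1 - q n) * (cmod (\<alpha> n) * c n) + (1 - (1/2) ^ Suc (Suc (2 * n))) * (cmod (\<alpha> n) * c n)"
        using q'[of n] c[of n] by (intro add_left_mono mult_right_mono) auto
      finally show "(1 - (1 - (1 - q n) / (1 + q n))) * cmod (\<alpha> n) \<le> (1 - (1/2) ^ Suc (2 * n)) * cmod (a (2 * n))
            + (1 - (1/2) ^ Suc (Suc (2 * n))) * cmod (a (Suc (2 * n)))"
        using c[of n] by (simp only: a_def norm_mult q_def) (simp add: norm_mult)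
    qed
    also have "\<dots> = (\<Sum>i<2 * N. (1 - (1/2) ^ Suc i) * cmod (a i))" by (simp only: sum_pairs)
    also have "\<dots> \<le> norm (\<Sum>i<2 * N. a i *\<^sub>C z i)" by (rule ge)
    also have "(\<Sum>i<2 * N. a i *\<^sub>C z i) = (\<Sum>n<N. \<alpha> n *\<^sub>C complex_of_real (c n) *\<^sub>C (z (2 * n) - z (Suc (2 * n))))"
      unfolding sum_pairs
      by (intro sum.cong) (auto simp: a_def scaleC_scaleC complex_vector.scale_right_diff_distrib)
    finally show "(\<Sum>n<N. (1 - (1 - (1 - q n) / (1 + q n))) * cmod (\<alpha> n))
        \<le> norm (\<Sum>n<N. \<alpha> n *\<^sub>C complex_of_real (c n) *\<^sub>C (z (2 * n) - z (Suc (2 * n))))" .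
  qed
  then show ?thesis by (rule that)
qed

theorem L_embedded_subspace_asymptotic_l1:
  fixes Y :: "'a::{complex_normed_vector, banach} set"
  assumes "L_embedded (UNIV :: 'a set)" and Y: "csubspace Y" "closed Y" "\<not> reflexive_space Y"
  obtains x where "\<And>n. x n \<in> Y" "spans_l1_asymptotically x"
proof -
  obtain x \<psi> where \<psi>: "clinear_on (dual_space (UNIV :: 'a set) norm) \<psi>"
    "\<And>f. f \<in> dual_space UNIV norm \<Longrightarrow> (\<And>u. cmod (f u) \<le> norm u) \<Longrightarrow> cmod (\<psi> f) \<le> 1"
    "\<And>g. g \<in> dual_space UNIV norm \<Longrightarrow> (\<And>y. y \<in> Y \<Longrightarrow> g y = 0) \<Longrightarrow> \<psi> g = - g x"
    and singular: "\<And>e \<alpha> \<epsilon>. \<epsilon> > 0 \<Longrightarrow> \<exists>f\<in>dual_space UNIV norm. (\<forall>u. cmod (f u) \<le> norm u) \<and>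
      norm e + cmod \<alpha> - \<epsilon> < cmod (f e + \<alpha> * \<psi> f)"
    by (rule L_embedded_singular_functional[OF assms]) blast
  have helly: "\<exists>z. z + x \<in> Y \<and> norm z \<le> 1 + \<epsilon> \<and> (\<forall>f\<in>F. f z = \<psi> f)"
    if "finite F" "F \<subseteq> dual_space UNIV norm" "\<epsilon> > 0" for F \<epsilon>
    by (rule Helly_translate[OF Y(1) \<psi> that]) blast+
  have step: "\<exists>z. z + x \<in> Y \<and> norm z \<le> 1 + \<epsilon> \<and>
      (\<forall>e \<alpha>. (e, \<alpha>) \<in> K \<longrightarrow> norm e + cmod \<alpha> - \<epsilon> \<le> norm (e + \<alpha> *\<^sub>C z))"
    if "compact K" "\<epsilon> > 0" for K \<epsilon>
    by (rule singular_step_compact[OF helly singular that]) blast+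
  obtain z where z: "\<And>n. z n + x \<in> Y" "\<And>n. norm (z n) \<le> 1 + (1/2) ^ Suc n"
    "\<And>n a. (\<Sum>i<n. (1 - (1/2) ^ Suc i) * cmod (a i)) \<le> norm (\<Sum>i<n. a i *\<^sub>C z i)"
    by (rule almost_l1_sequence[OF step]) blast+
  obtain c where c: "spans_l1_asymptotically (\<lambda>n. c n *\<^sub>C (z (2 * n) - z (Suc (2 * n))))"
    using spans_l1_asymptotically_differences[OF z(2,3)] by blast
  have "c n *\<^sub>C (z (2 * n) - z (Suc (2 * n))) \<in> Y" for n
    using complex_vector.subspace_diff[OF Y(1) z(1) z(1), of "2 * n" "Suc (2 * n)"]
    by (intro complex_vector.subspace_scale[OF Y(1)]) simp
  then show ?thesis using c by (rule that)
qed

section \<open>Failure of the fixed point property\<close>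

lemma norm_suminf_scaleR_le:
  fixes y :: "nat \<Rightarrow> 'a::banach"
  assumes "\<And>n. norm (y n) \<le> b n" "summable (\<lambda>n. \<bar>t n\<bar> * b n)"
  shows "summable (\<lambda>n. t n *\<^sub>R y n)" "norm (\<Sum>n. t n *\<^sub>R y n) \<le> (\<Sum>n. \<bar>t n\<bar> * b n)"
proof -
  have le: "norm (t n *\<^sub>R y n) \<le> \<bar>t n\<bar> * b n" for n
    using assms(1)[of n] by (simp add: mult_left_mono)
  then have sn: "summable (\<lambda>n. norm (t n *\<^sub>R y n))"
    by (intro summable_comparison_test'[OF assms(2)]) simp
  then show "summable (\<lambda>n. t n *\<^sub>R y n)" by (rule summable_norm_cancel)
  show "norm (\<Sum>n. t n *\<^sub>R y n) \<le> (\<Sum>n. \<bar>t n\<bar> * b n)"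
    using summable_norm[OF sn] suminf_le[OF le sn assms(2)] by linarith
qed

text \<open>The strict inequality compares \<open>\<ell>\<^sup>1\<close> norms for neighbouring
  weights: along a subsequence the lower constant is so close to 1 that
  \<open>(1 - \<delta> (r n)) * l n\<close> still exceeds \<open>l (Suc n)\<close>. The right side
  measures a combination of the weighted vectors, while the left side bounds the same combination
  after a shift by one place.\<close>

lemma decreasing_weights_exist:
  fixes x :: "nat \<Rightarrow> 'a::{complex_normed_vector, banach}"
  assumes x: "spans_l1_asymptotically x"
  obtains l :: "nat \<Rightarrow> real" and r where "\<And>n. 1 < l n" "\<And>n. l n \<le> 2" "\<And>n. norm (x (r n)) \<le> 1"
    "\<And>t n. summable (\<lambda>n. \<bar>t n\<bar>) \<Longrightarrow> t n \<noteq> 0 \<Longrightarrow>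
      (\<Sum>n. \<bar>t n\<bar> * l (Suc n)) < norm (\<Sum>n. t n *\<^sub>R l n *\<^sub>R x (r n))"
proof -
  obtain \<delta> where \<delta>: "\<And>n. \<delta> n \<in> {0..<1}" "\<delta> \<longlonglongrightarrow> (0::real)"
    and ge: "\<And>\<alpha>. summable (\<lambda>n. cmod (\<alpha> n)) \<Longrightarrow>
      (\<Sum>n. (1 - \<delta> n) * cmod (\<alpha> n)) \<le> norm (\<Sum>n. \<alpha> n *\<^sub>C x n)"
    and le: "\<And>\<alpha>. summable (\<lambda>n. cmod (\<alpha> n)) \<Longrightarrow>
      norm (\<Sum>n. \<alpha> n *\<^sub>C x n) \<le> (\<Sum>n. cmod (\<alpha> n))"
    using x unfolding spans_l1_asymptotically_def by blast
  define l :: "nat \<Rightarrow> real" where "l n = 1 + 1 / (real n + 1)" for n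
  have l: "1 < l n" "l n \<le> 2" "l (Suc n) < l n" for n
    by (auto simp: l_def field_simps)
  have l0: "0 \<le> l n" for n using l(1)[of n] by simp
  have norm_x: "norm (x m) \<le> 1" for m
  proof -
    have "(\<lambda>n. (if n = m then 1 else 0) *\<^sub>C x n) = (\<lambda>n. if n = m then x n else 0)" 
      "(\<lambda>n. cmod (if n = m then 1 else 0)) = (\<lambda>n. if n = m then 1 else 0)"
      by (auto simp: scaleC_one)
    moreover have "(\<lambda>n. if n = m then x n else 0) sums x m" "(\<lambda>n. if n = m then 1 else 0 :: real) sums 1"
      using sums_single[of m x] sums_single[of m "\<lambda>_. 1::real"] by auto
    ultimately show ?thesis
      using le[of "\<lambda>n. if n = m then 1 else 0"] by (simp add: sums_iff)
  qed
  \<comment> \<open>The strict decrease of \<open>l\<close> leaves a positive margin at every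
    \<open>n\<close>, and \<delta> eventually falls below it. The demand \<open>k > m\<close> makes
    the selected indices strictly increasing.\<close>
  have ev: "\<exists>k>m. \<delta> k < 1 - l (Suc n) / l n" for m n
  proof -
    have "0 < 1 - l (Suc n) / l n" using l(1)[of n] l(3)[of n] by (simp add: field_simps)
    then have "\<forall>\<^sub>F k in sequentially. \<delta> k < 1 - l (Suc n) / l n \<and> m < k"
      using order_tendstoD(2)[OF \<delta>(2)] eventually_gt_at_top[of m] eventually_conj by blast
    then show ?thesis using eventually_happens[of _ sequentially] by auto
  qed
  have "\<exists>r. \<forall>n. \<delta> (r n) < 1 - l (Suc n) / l n \<and> r n < r (Suc n)"
    by (rule dependent_nat_choice) (use ev in blast)+
  then obtain r where r: "\<And>n. \<delta> (r n) < 1 - l (Suc n) / l n" and mono: "strict_mono r"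
    by (auto simp: strict_mono_Suc_iff)
  have key: "(\<Sum>n. \<bar>t n\<bar> * l (Suc n)) < norm (\<Sum>n. t n *\<^sub>R l n *\<^sub>R x (r n))"
    if t: "summable (\<lambda>n. \<bar>t n\<bar>)" "t m \<noteq> 0" for t m
  proof -
    \<comment> \<open>The coefficients are carried to the indices of the subsequence and are 0
      elsewhere, so the estimate for the full sequence applies.\<close>
    define \<alpha> where "\<alpha> k = (if k \<in> range r then complex_of_real (t (inv r k) * l (inv r k)) else 0)" for k
    have \<alpha>_r: "\<alpha> (r n) = complex_of_real (t n * l n)" for n
      using mono by (simp add: \<alpha>_def strict_mono_imp_inj_on)
    have \<alpha>_0: "\<alpha> k = 0" if "k \<notin> range r" for k using that by (simp add: \<alpha>_def)
    have *: "summable (\<lambda>n. \<bar>t n\<bar> * c n)" if "\<And>n. 0 \<le> c n" "\<And>n. c n \<le> 2" for c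
    proof (rule summable_comparison_test'[OF summable_mult[OF t(1), of 2]])
      fix n show "norm (\<bar>t n\<bar> * c n) \<le> 2 * \<bar>t n\<bar>"
        using mult_left_mono[OF that(2)[of n], of "\<bar>t n\<bar>"] that(1)[of n] by (simp add: abs_mult)
    qed
    have cmod_\<alpha>: "cmod (\<alpha> (r n)) = \<bar>t n\<bar> * l n" for n
      using l(1)[of n] by (simp add: \<alpha>_r abs_mult norm_mult)
    have "summable (\<lambda>n. \<bar>t n\<bar> * l n)" using l0 l(2) by (intro *)
    then have "summable (\<lambda>n. cmod (\<alpha> (r n)))" by (simp add: cmod_\<alpha>)
    then have "summable (\<lambda>k. cmod (\<alpha> k))"
      using summable_mono_reindex[OF mono, of "\<lambda>k. cmod (\<alpha> k)"] \<alpha>_0 by simp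
    then have "(\<Sum>k. (1 - \<delta> k) * cmod (\<alpha> k)) \<le> norm (\<Sum>k. \<alpha> k *\<^sub>C x k)" by (rule ge)
    also have "(\<Sum>k. (1 - \<delta> k) * cmod (\<alpha> k)) = (\<Sum>n. \<bar>t n\<bar> * ((1 - \<delta> (r n)) * l n))"
      using suminf_mono_reindex[OF mono, of "\<lambda>k. (1 - \<delta> k) * cmod (\<alpha> k)"] \<alpha>_0
      by (simp add: cmod_\<alpha> mult_ac)
    also have "(\<Sum>k. \<alpha> k *\<^sub>C x k) = (\<Sum>n. t n *\<^sub>R l n *\<^sub>R x (r n))"
      using suminf_mono_reindex[OF mono, of "\<lambda>k. \<alpha> k *\<^sub>C x k"] \<alpha>_0
      by (simp add: \<alpha>_r scaleR_scaleC scaleC_scaleC)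
    finally have lower: "(\<Sum>n. \<bar>t n\<bar> * ((1 - \<delta> (r n)) * l n)) \<le> norm (\<Sum>n. t n *\<^sub>R l n *\<^sub>R x (r n))" .
    have step: "l (Suc n) < (1 - \<delta> (r n)) * l n" for n
      using r[of n] l(1)[of n] by (simp add: field_simps)
    have upper: "(1 - \<delta> (r n)) * l n \<le> 2" for n
    proof -
      have "(1 - \<delta> (r n)) * l n \<le> 1 * l n"
        using \<delta>(1)[of "r n"] l0[of n] by (intro mult_right_mono) auto
      then show ?thesis using l(2)[of n] by linarith
    qed
    have s1: "summable (\<lambda>n. \<bar>t n\<bar> * l (Suc n))"
      using l0 l(2) by (intro *)
    have s2: "summable (\<lambda>n. \<bar>t n\<bar> * ((1 - \<delta> (r n)) * l n))"
      using upper \<delta>(1) l0 by (intro *) (auto intro!: mult_nonneg_nonneg simp: less_imp_le)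
    \<comment> \<open>All terms are nonnegative, and the one at the nonzero coefficient
      \<open>t m\<close> gives strictness.\<close>
    have "0 < (\<Sum>n. \<bar>t n\<bar> * ((1 - \<delta> (r n)) * l n) - \<bar>t n\<bar> * l (Suc n))"
    proof (rule suminf_pos2[OF summable_diff[OF s2 s1]])
      show "0 \<le> \<bar>t n\<bar> * ((1 - \<delta> (r n)) * l n) - \<bar>t n\<bar> * l (Suc n)" for n
        using step[of n] by (simp add: mult_left_mono)
      show "0 < \<bar>t m\<bar> * ((1 - \<delta> (r m)) * l m) - \<bar>t m\<bar> * l (Suc m)"
        using step[of m] t(2) by (simp add: mult_strict_left_mono)
    qed
    then show ?thesis using lower suminf_diff[OF s2 s1] by simp
  qed
  show ?thesis
    by (rule that[of l r]) (use l norm_x key in auto)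
qed

section \<open>Infinite convex combinations\<close>

text \<open>Infinite convex combinations are used from the start. Under a lower
  \<open>\<ell>\<^sup>1\<close> estimate they already form a closed set, whose points have unique
  coefficients on which a shift can act.\<close>

definition prob_seqs :: "(nat \<Rightarrow> real) set"
  where "prob_seqs = {t. (\<forall>n. 0 \<le> t n) \<and> t sums 1}"

lemma prob_seqs_summable:
  assumes "t \<in> prob_seqs"
  shows "summable (\<lambda>n. \<bar>t n\<bar>)" "(\<Sum>n. \<bar>t n\<bar>) = 1"
  using assms by (auto simp: prob_seqs_def sums_iff)

text \<open>Completeness of real \<open>\<ell>\<^sup>1\<close> for plain functions: the limit is
  taken coordinatewise, and the uniform Cauchy bounds on finite partial sums pass to it.\<close>

lemma l1_Cauchy_limit:
  fixes t :: "nat \<Rightarrow> nat \<Rightarrow> real"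
  assumes sm: "\<And>k. summable (\<lambda>n. \<bar>t k n\<bar>)"
    and cauchy: "\<And>\<epsilon>. \<epsilon> > 0 \<Longrightarrow> \<exists>M. \<forall>k\<ge>M. \<forall>j\<ge>M. (\<Sum>n. \<bar>t k n - t j n\<bar>) \<le> \<epsilon>"
  obtains s where "\<And>n. (\<lambda>k. t k n) \<longlonglongrightarrow> s n" "\<And>k. summable (\<lambda>n. \<bar>t k n - s n\<bar>)"
    "(\<lambda>k. \<Sum>n. \<bar>t k n - s n\<bar>) \<longlonglongrightarrow> 0"
proof -
  have sd: "summable (\<lambda>n. \<bar>t k n - t j n\<bar>)" for k j
    by (rule summable_comparison_test'[OF summable_add[OF sm[of k] sm[of j]]]) simp
  have part: "(\<Sum>n\<in>A. \<bar>t k n - t j n\<bar>) \<le> (\<Sum>n. \<bar>t k n - t j n\<bar>)" if "finite A" for A k j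
    by (rule sum_le_suminf[OF sd that]) simp
  have "Cauchy (\<lambda>k. t k n)" for n
  proof (rule CauchyI')
    fix e :: real assume "e > 0"
    then obtain M where M: "\<forall>k\<ge>M. \<forall>j\<ge>M. (\<Sum>n. \<bar>t k n - t j n\<bar>) \<le> e / 2" using cauchy[of "e / 2"] by auto
    then have "dist (t m n) (t k n) < e" if "m \<ge> M" "k > m" for m k
    proof -
      have "(\<Sum>n. \<bar>t m n - t k n\<bar>) \<le> e / 2" using M that by simp
      then show ?thesis using part[of "{n}" m k] \<open>e > 0\<close> by (simp add: dist_real_def)
    qed
    then show "\<exists>M. \<forall>m\<ge>M. \<forall>k>m. dist (t m n) (t k n) < e" by blast
  qed
  then have "\<exists>l. (\<lambda>k. t k n) \<longlonglongrightarrow> l" for n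
    using Cauchy_convergent convergent_def by blast
  then obtain s where s: "\<And>n. (\<lambda>k. t k n) \<longlonglongrightarrow> s n" by metis
  have tail: "\<exists>M. \<forall>k\<ge>M. \<forall>N. (\<Sum>n<N. \<bar>t k n - s n\<bar>) \<le> \<epsilon>" if pos: "\<epsilon> > 0" for \<epsilon>
  proof -
    obtain M where M: "\<forall>k\<ge>M. \<forall>j\<ge>M. (\<Sum>n. \<bar>t k n - t j n\<bar>) \<le> \<epsilon>" using cauchy[OF pos] by blast
    have "(\<Sum>n<N. \<bar>t k n - s n\<bar>) \<le> \<epsilon>" if k: "k \<ge> M" for k N
    proof (rule LIMSEQ_le_const2)
      show "(\<lambda>j. \<Sum>n<N. \<bar>t k n - t j n\<bar>) \<longlonglongrightarrow> (\<Sum>n<N. \<bar>t k n - s n\<bar>)"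
        by (intro tendsto_intros s)
      show "\<exists>J. \<forall>j\<ge>J. (\<Sum>n<N. \<bar>t k n - t j n\<bar>) \<le> \<epsilon>"
        using M k part[of "{..<N}" k] by (intro exI[of _ M]) (meson finite_lessThan order.trans)
    qed
    then show ?thesis by blast
  qed
  have sum_k: "summable (\<lambda>n. \<bar>t k n - s n\<bar>)" for k
  proof -
    obtain M where "\<forall>k\<ge>M. \<forall>N. (\<Sum>n<N. \<bar>t k n - s n\<bar>) \<le> 1" using tail[of 1] by auto
    then have sM: "summable (\<lambda>n. \<bar>t M n - s n\<bar>)" by (intro summableI_nonneg_bounded[where x=1]) auto
    show ?thesis
    proof (rule summable_comparison_test'[OF summable_add[OF sd[of k M] sM]])
      show "norm \<bar>t k n - s n\<bar> \<le> \<bar>t k n - t M n\<bar> + \<bar>t M n - s n\<bar>" for n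
        unfolding real_norm_def by linarith
    qed
  qed
  have "(\<lambda>k. \<Sum>n. \<bar>t k n - s n\<bar>) \<longlonglongrightarrow> 0"
  proof (rule LIMSEQ_I)
    fix e :: real assume "e > 0"
    then obtain M where M: "\<forall>k\<ge>M. \<forall>N. (\<Sum>n<N. \<bar>t k n - s n\<bar>) \<le> e / 2" using tail[of "e / 2"] by auto
    have "norm ((\<Sum>n. \<bar>t k n - s n\<bar>) - 0) < e" if "k \<ge> M" for k
    proof -
      have "(\<Sum>n. \<bar>t k n - s n\<bar>) \<le> e / 2"
        using M that by (intro suminf_le_const sum_k) blast
      then show ?thesis using \<open>e > 0\<close> suminf_nonneg[OF sum_k[of k]] by simp
    qed
    then show "\<exists>M. \<forall>k\<ge>M. norm ((\<Sum>n. \<bar>t k n - s n\<bar>) - 0) < e" by blast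
  qed
  then show ?thesis using s sum_k that by blast
qed

text \<open>The lower estimate turns a convergent sequence of images into an
  \<open>\<ell>\<^sup>1\<close> Cauchy sequence of coefficients. Convergence in
  \<open>\<ell>\<^sup>1\<close> is essential: coordinatewise limits of such coefficients may lose
  mass.\<close>

lemma closed_prob_seqs_image:
  fixes y :: "nat \<Rightarrow> 'a::banach"
  assumes bound: "\<And>n. norm (y n) \<le> B"
    and lower: "\<And>t. summable (\<lambda>n. \<bar>t n\<bar>) \<Longrightarrow> (\<Sum>n. \<bar>t n\<bar>) \<le> norm (\<Sum>n. t n *\<^sub>R y n)"
  shows "closed ((\<lambda>t. \<Sum>n. t n *\<^sub>R y n) ` prob_seqs)"
proof -
  let ?S = "\<lambda>t. \<Sum>n. t n *\<^sub>R y n"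
  have sy: "summable (\<lambda>n. t n *\<^sub>R y n)" and ny: "norm (?S t) \<le> (\<Sum>n. \<bar>t n\<bar>) * B"
    if "summable (\<lambda>n. \<bar>t n\<bar>)" for t
    using norm_suminf_scaleR_le[OF bound summable_mult2[OF that, of B]] suminf_mult2[OF that, of B] by auto
  have diff: "?S (\<lambda>n. t n - s n) = ?S t - ?S s" if "summable (\<lambda>n. \<bar>t n\<bar>)" "summable (\<lambda>n. \<bar>s n\<bar>)" for t s
    using suminf_diff[OF sy[OF that(1)] sy[OF that(2)]] by (simp add: scaleR_diff_left)
  have sdiff: "summable (\<lambda>n. \<bar>t n - s n\<bar>)" if "summable (\<lambda>n. \<bar>t n\<bar>)" "summable (\<lambda>n. \<bar>s n\<bar>)" for t s :: "nat \<Rightarrow> real"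
    by (rule summable_comparison_test'[OF summable_add[OF that]]) simp
  show ?thesis
  proof (rule closed_sequential_limits[THEN iffD2], intro allI impI, elim conjE)
    fix u v assume "\<forall>k. u k \<in> ?S ` prob_seqs" and uv: "u \<longlonglongrightarrow> v"
    then obtain t where t: "\<And>k. t k \<in> prob_seqs" "\<And>k. u k = ?S (t k)" 
      by (simp only: image_iff) metis
    note sm = prob_seqs_summable(1)[OF t(1)]
    have "\<exists>M. \<forall>k\<ge>M. \<forall>j\<ge>M. (\<Sum>n. \<bar>t k n - t j n\<bar>) \<le> \<epsilon>" if pos: "\<epsilon> > 0" for \<epsilon>
    proof -
      obtain M where M: "\<forall>k\<ge>M. \<forall>j\<ge>M. norm (u k - u j) < \<epsilon>"
        using CauchyD[OF LIMSEQ_imp_Cauchy[OF uv] pos] by blast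
      have "(\<Sum>n. \<bar>t k n - t j n\<bar>) \<le> norm (u k - u j)" for k j
        using lower[OF sdiff[OF sm sm], of k j] diff[OF sm sm, of k j] by (simp add: t(2))
      then show ?thesis using M by (intro exI[of _ M]) (meson less_imp_le order.trans)
    qed
    then obtain s where s: "\<And>n. (\<lambda>k. t k n) \<longlonglongrightarrow> s n" "\<And>k. summable (\<lambda>n. \<bar>t k n - s n\<bar>)"
      "(\<lambda>k. \<Sum>n. \<bar>t k n - s n\<bar>) \<longlonglongrightarrow> 0"
      using l1_Cauchy_limit[of t, OF sm] by blast
    have ss: "summable (\<lambda>n. \<bar>s n\<bar>)"
    proof (rule summable_comparison_test'[OF summable_add[OF sm[of 0] s(2)[of 0]]])
      show "norm \<bar>s n\<bar> \<le> \<bar>t 0 n\<bar> + \<bar>t 0 n - s n\<bar>" for n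
        unfolding real_norm_def by linarith
    qed
    have nonneg: "0 \<le> s n" for n
      using t(1) by (intro LIMSEQ_le_const[OF s(1)]) (auto simp: prob_seqs_def)
    \<comment> \<open>The sum is continuous for the \<open>\<ell>\<^sup>1\<close> distance, so the
      total mass 1 is kept in the limit.\<close>
    have "\<bar>1 - suminf s\<bar> \<le> (\<Sum>n. \<bar>t k n - s n\<bar>)" for k
    proof -
      have "1 - suminf s = (\<Sum>n. t k n - s n)"
        using suminf_diff[OF summable_rabs_cancel[OF sm[of k]] summable_rabs_cancel[OF ss]] t(1)[of k]
        by (simp add: prob_seqs_def sums_iff)
      then show ?thesis using summable_rabs[OF s(2)[of k]] by simp
    qed
    then have "\<bar>1 - suminf s\<bar> \<le> 0" by (intro LIMSEQ_le_const[OF s(3)]) auto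
    then have sP: "s \<in> prob_seqs"
      using nonneg summable_rabs_cancel[OF ss] by (simp add: prob_seqs_def sums_iff)
    have "(\<lambda>k. u k - ?S s) \<longlonglongrightarrow> 0"
    proof (rule Lim_null_comparison)
      show "\<forall>\<^sub>F k in sequentially. norm (u k - ?S s) \<le> (\<Sum>n. \<bar>t k n - s n\<bar>) * B"
        using ny[OF s(2)] diff[OF sm ss] by (simp add: t(2))
      show "(\<lambda>k. (\<Sum>n. \<bar>t k n - s n\<bar>) * B) \<longlonglongrightarrow> 0"
        using tendsto_mult_left_zero[OF s(3)] by simp
    qed
    then have "u \<longlonglongrightarrow> ?S s" by (simp add: LIM_zero_iff)
    then have "v = ?S s" using uv LIMSEQ_unique by blast
    then show "v \<in> ?S ` prob_seqs" using sP by blast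
  qed
qed

lemma convex_prob_seqs_image:
  fixes y :: "nat \<Rightarrow> 'a::banach"
  assumes sy: "\<And>t. t \<in> prob_seqs \<Longrightarrow> summable (\<lambda>n. t n *\<^sub>R y n)"
  shows "convex ((\<lambda>t. \<Sum>n. t n *\<^sub>R y n) ` prob_seqs)"
proof (rule convexI)
  let ?S = "\<lambda>t. \<Sum>n. t n *\<^sub>R y n"
  fix a b and u v :: real
  assume ab: "a \<in> ?S ` prob_seqs" "b \<in> ?S ` prob_seqs" and uv: "0 \<le> u" "0 \<le> v" "u + v = 1"
  obtain t s where t: "t \<in> prob_seqs" "a = ?S t" and s: "s \<in> prob_seqs" "b = ?S s" using ab by blast
  have "u *\<^sub>R a + v *\<^sub>R b = ?S (\<lambda>n. u * t n + v * s n)"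
    using suminf_add[OF summable_scaleR_right[OF sy[OF t(1)], of u] summable_scaleR_right[OF sy[OF s(1)], of v]]
      suminf_scaleR_right[OF sy[OF t(1)], of u] suminf_scaleR_right[OF sy[OF s(1)], of v]
    by (simp add: t(2) s(2) scaleR_add_left)
  moreover have "(\<lambda>n. u * t n + v * s n) sums (u * 1 + v * 1)"
    using t(1) s(1) by (intro sums_add sums_mult) (auto simp: prob_seqs_def)
  then have "(\<lambda>n. u * t n + v * s n) \<in> prob_seqs"
    using t(1) s(1) uv by (simp add: prob_seqs_def)
  ultimately show "u *\<^sub>R a + v *\<^sub>R b \<in> ?S ` prob_seqs" by (rule image_eqI)
qed

text \<open>
  The shift on the closed convex hull of \<open>l n *\<^sub>R x (r n)\<close> is contractive because the weights
  \<open>l n\<close> decrease by more than is lost in the lower \<open>\<ell>\<^sup>1\<close> estimate; a fixed point would have a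
  constant coefficient sequence starting with \<open>0\<close>.
\<close>

theorem asymptotic_l1_fails_fixed_point_property:
  fixes Y :: "'a::{complex_normed_vector, banach} set"
  assumes Y: "csubspace Y" "closed Y" and xY: "\<And>n. x n \<in> Y" and x: "spans_l1_asymptotically x"
  shows "\<not> fixed_point_property Y"
proof -
  obtain l r where l: "\<And>n. 1 < l n" "\<And>n. l n \<le> 2" and norm_x: "\<And>n. norm (x (r n)) \<le> 1"
    and key: "\<And>t n. summable (\<lambda>n. \<bar>t n\<bar>) \<Longrightarrow> t n \<noteq> 0 \<Longrightarrow>
      (\<Sum>n. \<bar>t n\<bar> * l (Suc n)) < norm (\<Sum>n. t n *\<^sub>R l n *\<^sub>R x (r n))"
    by (rule decreasing_weights_exist[OF x]) blast
  define y where "y n = l n *\<^sub>R x (r n)" for n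
  define S where "S t = (\<Sum>n. t n *\<^sub>R y n)" for t :: "nat \<Rightarrow> real"
  define C where "C = S ` prob_seqs"
  have ny: "norm (y n) \<le> l n" for n
    using mult_left_le[OF norm_x[of n], of "l n"] l(1)[of n] by (simp add: y_def)
  have sl: "summable (\<lambda>n. \<bar>t n\<bar> * l (Suc n))" if "summable (\<lambda>n. \<bar>t n\<bar>)" for t
  proof (rule summable_comparison_test'[OF summable_mult[OF that, of 2]])
    fix n show "norm (\<bar>t n\<bar> * l (Suc n)) \<le> 2 * \<bar>t n\<bar>"
      using mult_left_mono[OF l(2)[of "Suc n"], of "\<bar>t n\<bar>"] l(1)[of "Suc n"] by (simp add: abs_mult)
  qed
  have key': "(\<Sum>n. \<bar>t n\<bar> * l (Suc n)) < norm (S t)" if "summable (\<lambda>n. \<bar>t n\<bar>)" "t n \<noteq> 0" for t n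
    using key[OF that] by (simp add: S_def y_def)
  have lower: "(\<Sum>n. \<bar>t n\<bar>) \<le> norm (S t)" if t: "summable (\<lambda>n. \<bar>t n\<bar>)" for t
  proof (cases "\<exists>n. t n \<noteq> 0")
    case True
    have "\<bar>t n\<bar> \<le> \<bar>t n\<bar> * l (Suc n)" for n
      using mult_left_mono[of 1 "l (Suc n)" "\<bar>t n\<bar>"] l(1)[of "Suc n"] by simp
    then have "(\<Sum>n. \<bar>t n\<bar>) \<le> (\<Sum>n. \<bar>t n\<bar> * l (Suc n))" by (intro suminf_le t sl)
    then show ?thesis using True key'[OF t] by force
  qed simp
  have y2: "norm (y n) \<le> 2" for n using ny[of n] l(2)[of n] by simp
  have sy: "summable (\<lambda>n. t n *\<^sub>R y n)" and nS: "norm (S t) \<le> (\<Sum>n. \<bar>t n\<bar>) * 2"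
    if "summable (\<lambda>n. \<bar>t n\<bar>)" for t
    using norm_suminf_scaleR_le[OF y2 summable_mult2[OF that, of 2]] suminf_mult2[OF that, of 2]
    by (auto simp: S_def)
  have diff: "S t - S s = S (\<lambda>n. t n - s n)" if "summable (\<lambda>n. \<bar>t n\<bar>)" "summable (\<lambda>n. \<bar>s n\<bar>)" for t s
    using suminf_diff[OF sy[OF that(1)] sy[OF that(2)]] by (simp add: scaleR_diff_left S_def)
  have sdiff: "summable (\<lambda>n. \<bar>t n - s n\<bar>)" if "summable (\<lambda>n. \<bar>t n\<bar>)" "summable (\<lambda>n. \<bar>s n\<bar>)" for t s :: "nat \<Rightarrow> real"
    by (rule summable_comparison_test'[OF summable_add[OF that]]) simp
  note ps = prob_seqs_summable(1)
  \<comment> \<open>Uniqueness of the coefficients lets the shift on sequences be transported to a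
    well-defined map on \<open>C\<close>.\<close>
  have inj: "inj_on S prob_seqs"
  proof (rule inj_onI, rule ccontr)
    fix t s assume ts: "t \<in> prob_seqs" "s \<in> prob_seqs" "S t = S s" "t \<noteq> s"
    then obtain n where "t n - s n \<noteq> 0" by (auto simp: fun_eq_iff)
    then have "(\<Sum>n. \<bar>t n - s n\<bar> * l (Suc n)) < 0"
      using key'[OF sdiff[OF ps[OF ts(1)] ps[OF ts(2)]], of n] diff[OF ps[OF ts(1)] ps[OF ts(2)]] ts(3) by simp
    moreover have "0 \<le> (\<Sum>n. \<bar>t n - s n\<bar> * l (Suc n))"
      using l(1) by (intro suminf_nonneg sl[OF sdiff[OF ps[OF ts(1)] ps[OF ts(2)]]]) (simp add: less_imp_le order.trans[OF zero_le_one])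
    ultimately show False by simp
  qed
  \<comment> \<open>The inserted leading 0 preserves the total mass and moves \<open>y n\<close> to
    \<open>y (Suc n)\<close>.\<close>
  define T where "T t = case_nat 0 t" for t :: "nat \<Rightarrow> real"
  have TP: "T t \<in> prob_seqs" if "t \<in> prob_seqs" for t
    using that sums_Suc[of "T t" 1] by (auto simp: T_def prob_seqs_def split: nat.split)
  define f where "f = S \<circ> T \<circ> the_inv_into prob_seqs S"
  have f: "f (S t) = S (T t)" if "t \<in> prob_seqs" for t
    using the_inv_into_f_f[OF inj that] by (simp add: f_def)
  \<comment> \<open>The coefficient differences of the shifted points meet \<open>y (Suc n)\<close>,
    of norm at most \<open>l (Suc n)\<close>. The triangle inequality thus gives exactly the
    weighted sum that \<open>key'\<close> places strictly below the original distance.\<close>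
  have contr: "dist (S (T t)) (S (T s)) < dist (S t) (S s)"
    if ts: "t \<in> prob_seqs" "s \<in> prob_seqs" "S t \<noteq> S s" for t s
  proof -
    let ?d = "\<lambda>n. t n - s n"
    note sums = ps[OF ts(1)] ps[OF ts(2)]
    note Tsums = ps[OF TP[OF ts(1)]] ps[OF TP[OF ts(2)]]
    obtain n where n: "?d n \<noteq> 0" using ts(3) by (metis eq_iff_diff_eq_0 ext)
    have "S (T t) - S (T s) = (\<Sum>n. (T t n - T s n) *\<^sub>R y n)" using diff[OF Tsums] by (simp add: S_def)
    also have "\<dots> = (\<Sum>n. ?d n *\<^sub>R y (Suc n))"
      using suminf_split_head[OF sy[OF sdiff[OF Tsums]]] by (simp add: T_def)
    finally have "norm (S (T t) - S (T s)) \<le> (\<Sum>n. \<bar>?d n\<bar> * l (Suc n))"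
      using norm_suminf_scaleR_le(2)[of "\<lambda>n. y (Suc n)" "\<lambda>n. l (Suc n)" ?d, OF ny sl[OF sdiff[OF sums]]] by simp
    also have "\<dots> < norm (S t - S s)" using key'[OF sdiff[OF sums] n] diff[OF sums] by simp
    finally show ?thesis by (simp add: dist_norm)
  qed
  have no_fixed: "S (T t) \<noteq> S t" if t: "t \<in> prob_seqs" for t
  proof
    assume "S (T t) = S t"
    then have eq: "T t = t" using inj TP[OF t] t by (auto dest: inj_onD)
    have "t n = 0" for n
    proof (induction n)
      case 0 then show ?case using fun_cong[OF eq, of 0] by (simp add: T_def)
    next
      case (Suc n) then show ?case using fun_cong[OF eq, of "Suc n"] by (simp add: T_def)
    qed
    then have "t = (\<lambda>_. 0)" by auto
    then have "(\<lambda>_. 0 :: real) sums 1" using t by (simp add: prob_seqs_def)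
    then show False using sums_unique2[OF sums_zero] by force
  qed
  have "C \<noteq> {}"
  proof -
    have "(\<lambda>n. if n = 0 then 1 else 0) \<in> prob_seqs"
      using sums_single[of 0 "\<lambda>_. 1::real"] by (simp add: prob_seqs_def)
    then show ?thesis by (auto simp: C_def)
  qed
  moreover have "C \<subseteq> Y"
  proof
    fix u assume "u \<in> C"
    then obtain t where t: "t \<in> prob_seqs" "u = S t" by (auto simp: C_def)
    have "(\<Sum>n<N. t n *\<^sub>R y n) \<in> Y" for N
      using xY by (intro complex_vector.subspace_sum[OF Y(1)])
        (simp add: y_def scaleR_scaleC complex_vector.subspace_scale[OF Y(1)])
    then show "u \<in> Y"
      using closed_sequentially[OF Y(2) _ summable_LIMSEQ[OF sy[OF ps[OF t(1)]]]] by (simp add: t(2) S_def)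
  qed
  moreover have "closed C"
    unfolding C_def S_def[abs_def] by (rule closed_prob_seqs_image[OF y2]) (use lower in \<open>simp add: S_def\<close>)
  moreover have "bounded C"
    unfolding bounded_iff
  proof (intro exI ballI)
    fix u assume "u \<in> C"
    then obtain t where "t \<in> prob_seqs" "u = S t" by (auto simp: C_def)
    then show "norm u \<le> 2" using nS[OF ps, of t] prob_seqs_summable(2)[of t] by simp
  qed
  moreover have "convex C"
    unfolding C_def S_def[abs_def] by (rule convex_prob_seqs_image[OF sy[OF ps]])
  moreover have "f ` C \<subseteq> C" using f TP by (auto simp: C_def)
  moreover have "contractive_on C f"
    unfolding contractive_on_def
  proof (intro ballI impI)
    fix u v assume "u \<in> C" "v \<in> C" "u \<noteq> v"
    then obtain t s where "t \<in> prob_seqs" "u = S t" "s \<in> prob_seqs" "v = S s"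
      by (auto simp: C_def)
    with \<open>u \<noteq> v\<close> show "dist (f u) (f v) < dist u v" by (simp add: f contr)
  qed
  moreover have "\<not> (\<exists>u\<in>C. f u = u)" using no_fixed f by (auto simp: C_def)
  ultimately show ?thesis
    unfolding fixed_point_property_def using closed_subset[of C Y] by metis
qed

theorem corollary4:
  fixes Y :: "'a::{complex_normed_vector, banach} set"
  assumes "L_embedded (UNIV :: 'a set)"
    and "csubspace Y" and "closed Y"
    and "\<not> reflexive_space Y"
  shows "(\<exists>x :: nat \<Rightarrow> 'a. (\<forall>n. x n \<in> Y) \<and> spans_l1_asymptotically x) \<and>
    \<not> fixed_point_property Y"
proof -
  obtain x where x: "\<And>n. x n \<in> Y" "spans_l1_asymptotically x"
    using L_embedded_subspace_asymptotic_l1[OF assms] by blast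
  with asymptotic_l1_fails_fixed_point_property[OF assms(2,3)] show ?thesis by blast
qed

end
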